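(* Let $\rho\in\mathcal{D}_{=}(SLE)$ and let $|\rho\rangle\langle\rho|_{SLEP}$ be a purification of $\rho_{SLE}$. Let $\delta\ge 0$. Suppose there exist finite-dimensional registers $X,Y,Q$, a state $\rho_{XY}\in\mathcal{D}_{=}(XY)$, and channels $\mathcal{E}:LPX\to PQ$ (encoding) and $\mathcal{D}:QEY\to LE$ (decoding) such that $$P\big(\rho_{SLEP},\,(\mathcal{D}\circ\mathcal{E})(|\rho\rangle\langle\rho|_{SLEP}\otimes\rho_{XY})\big)\le\delta$$ (i.e. a $\delta$-quantum state redistribution protocol for $\rho$ in which Alice holds $PL$, Bob initially holds $E$, the reference holds $S$, the register to be transmitted is $L$, and $Q$ is the message register). Then for any $\epsilon\in[0,1)$ with $\epsilon+\delta<1$, $$H_{\min}^{\uparrow,\epsilon+\delta}(S|LE)_\rho\ \ge\ H_{\min}^{\uparrow,\epsilon}(S|E)_\rho-2\log|Q|.$$ If moreover the register $Q$ is classical (the output of $\mathcal{E}$ is always classical on $Q$), then $2\log|Q|$ may be replaced by $\log|Q|$.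
   Context: All registers are finite-dimensional; $\log$ is base $2$; $|Q|$ is the dimension of $Q$. $\mathcal{D}_{=}(A)$ (resp. $\mathcal{D}_{\le}(A)$) denotes normalized (resp. subnormalized) density operators on $A$, $\mathrm{Pos}(A)$ the positive semidefinite operators. Identity channels on untouched registers are left implicit. For $\rho,\sigma\in\mathcal{D}_{\le}(A)$ the generalized fidelity is $F(\rho,\sigma)=\|\sqrt\rho\sqrt\sigma\|_1+\sqrt{(1-\mathrm{Tr}\rho)(1-\mathrm{Tr}\sigma)}$ and the purified distance is $P(\rho,\sigma)=\sqrt{1-F(\rho,\sigma)^2}$. The max-divergence is $D_\infty(\rho\|\sigma)=\log\inf\{\mu\ge0:\rho\le\mu\sigma\}$ ($+\infty$ if no such $\mu$). $H^\uparrow_\infty(A|B)_\rho=-\inf_{\sigma_B\in\mathcal{D}_{\le}(B)}D_\infty(\rho_{AB}\|\mathbb{1}_A\otimes\sigma_B)$, and for $\epsilon\in[0,\sqrt{\mathrm{Tr}\rho})$ the smooth min-entropy is $H_{\min}^{\uparrow,\epsilon}(A|B)_\rho=\sup\{H^\uparrow_\infty(A|B)_{\tilde\rho}:\tilde\rho\in\mathcal{D}_{\le}(AB),P(\tilde\rho,\rho)\le\epsilon\}$. *)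

theory Defs
  imports Complex_Main "HOL-Library.Extended_Real"
begin

text \<open>Operators on finite-dimensional registers. A register is a finite type; its
  Hilbert space is the space of functions from that type to complex numbers, with the
  standard orthonormal basis indexed by the type. A (rectangular) matrix is a function
  of two indices; the register AB is the product type.\<close>

type_synonym ('a, 'b) cmat = "'a \<Rightarrow> 'b \<Rightarrow> complex"
type_synonym 'a qop = "('a, 'a) cmat"

definition mmult :: "('a, 'b::finite) cmat \<Rightarrow> ('b, 'c) cmat \<Rightarrow> ('a, 'c) cmat" where
  "mmult A B = (\<lambda>i k. \<Sum>j\<in>UNIV. A i j * B j k)"

definition adjoint :: "('a, 'b) cmat \<Rightarrow> ('b, 'a) cmat" where
  "adjoint A = (\<lambda>i j. cnj (A j i))"

definition idm :: "'a qop" where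
  "idm = (\<lambda>i j. if i = j then 1 else 0)"

definition mtrace :: "('a::finite) qop \<Rightarrow> complex" where
  "mtrace A = (\<Sum>i\<in>UNIV. A i i)"

definition psd :: "('a::finite) qop \<Rightarrow> bool" where
  "psd A \<longleftrightarrow> (\<forall>v :: 'a \<Rightarrow> complex.
      (\<Sum>i\<in>UNIV. \<Sum>j\<in>UNIV. cnj (v i) * A i j * v j) \<in> \<real> \<and>
      0 \<le> Re (\<Sum>i\<in>UNIV. \<Sum>j\<in>UNIV. cnj (v i) * A i j * v j))"

definition loewner_le :: "('a::finite) qop \<Rightarrow> 'a qop \<Rightarrow> bool" where
  "loewner_le A B \<longleftrightarrow> psd (\<lambda>i j. B i j - A i j)"

definition density_eq :: "('a::finite) qop \<Rightarrow> bool" where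
  "density_eq \<rho> \<longleftrightarrow> psd \<rho> \<and> mtrace \<rho> = 1"

definition density_le :: "('a::finite) qop \<Rightarrow> bool" where
  "density_le \<rho> \<longleftrightarrow> psd \<rho> \<and> Re (mtrace \<rho>) \<le> 1"

definition sqrtm :: "('a::finite) qop \<Rightarrow> 'a qop" where
  "sqrtm A = (THE B. psd B \<and> mmult B B = A)"

definition trace_norm :: "('a::finite) qop \<Rightarrow> real" where
  "trace_norm M = Re (mtrace (sqrtm (mmult (adjoint M) M)))"

definition gen_fidelity :: "('a::finite) qop \<Rightarrow> 'a qop \<Rightarrow> real" where
  "gen_fidelity \<rho> \<sigma> = trace_norm (mmult (sqrtm \<rho>) (sqrtm \<sigma>))
      + sqrt ((1 - Re (mtrace \<rho>)) * (1 - Re (mtrace \<sigma>)))"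

definition purified_dist :: "('a::finite) qop \<Rightarrow> 'a qop \<Rightarrow> real" where
  "purified_dist \<rho> \<sigma> = sqrt (1 - (gen_fidelity \<rho> \<sigma>)\<^sup>2)"

text \<open>Max-divergence \<open>log inf {\<mu> \<ge> 0. \<rho> \<le> \<mu> \<sigma>}\<close> with \<open>log 0 = -\<infinity>\<close>, \<open>inf {} = +\<infinity>\<close>.\<close>
definition Dmax :: "('a::finite) qop \<Rightarrow> 'a qop \<Rightarrow> ereal" where
  "Dmax \<rho> \<sigma> = Inf ((\<lambda>\<mu>::real. if \<mu> = 0 then -\<infinity> else ereal (log 2 \<mu>)) `
      {\<mu>. 0 \<le> \<mu> \<and> loewner_le \<rho> (\<lambda>i j. complex_of_real \<mu> * \<sigma> i j)})"

definition tensor :: "('a, 'b) cmat \<Rightarrow> ('c, 'd) cmat \<Rightarrow> ('a \<times> 'c, 'b \<times> 'd) cmat" where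
  "tensor A B = (\<lambda>(a, c) (b, d). A a b * B c d)"

definition Hmin_up :: "('a::finite \<times> 'b::finite) qop \<Rightarrow> ereal" where
  "Hmin_up \<rho> = - (INF \<sigma>\<in>{\<sigma> :: 'b qop. density_le \<sigma>}. Dmax \<rho> (tensor idm \<sigma>))"

definition smooth_Hmin_up :: "real \<Rightarrow> ('a::finite \<times> 'b::finite) qop \<Rightarrow> ereal" where
  "smooth_Hmin_up \<epsilon> \<rho> =
     (SUP \<rho>'\<in>{\<rho>'. density_le \<rho>' \<and> purified_dist \<rho>' \<rho> \<le> \<epsilon>}. Hmin_up \<rho>')"

definition ptrace2 :: "('a \<times> 'b::finite) qop \<Rightarrow> 'a qop" where
  "ptrace2 M = (\<lambda>a a'. \<Sum>b\<in>UNIV. M (a, b) (a', b))"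

definition ketbra :: "('a \<Rightarrow> complex) \<Rightarrow> 'a qop" where
  "ketbra \<psi> = (\<lambda>i j. \<psi> i * cnj (\<psi> j))"

text \<open>Relabelling of the basis along a bijection \<open>f\<close> (new index \<mapsto> old index);
  used to reorder tensor factors.\<close>
definition reindex :: "('b \<Rightarrow> 'a) \<Rightarrow> 'a qop \<Rightarrow> 'b qop" where
  "reindex f M = (\<lambda>i j. M (f i) (f j))"

text \<open>\<open>id\<^sub>R \<otimes> \<Phi>\<close> for a linear map \<open>\<Phi>\<close>: acts blockwise on the second factor.\<close>
definition app2 :: "('a qop \<Rightarrow> 'b qop) \<Rightarrow> ('r \<times> 'a) qop \<Rightarrow> ('r \<times> 'b) qop" where
  "app2 \<Phi> M = (\<lambda>(r, b) (r', b'). \<Phi> (\<lambda>a a'. M (r, a) (r', a')) b b')"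

definition is_channel :: "(('a::finite) qop \<Rightarrow> ('b::finite) qop) \<Rightarrow> bool" where
  "is_channel \<Phi> \<longleftrightarrow> (\<exists>(n::nat) (K :: nat \<Rightarrow> ('b, 'a) cmat).
      (\<forall>M. \<Phi> M = (\<lambda>i j. \<Sum>k<n. mmult (mmult (K k) M) (adjoint (K k)) i j)) \<and>
      (\<lambda>i j. \<Sum>k<n. mmult (adjoint (K k)) (K k) i j) = idm)"

end

theory Submission
  imports "HOL-Analysis.Analysis" Defs
begin

text \<open>Let \<open>\<rho>'\<close> be \<open>\<epsilon>\<close>-close to \<open>\<rho>\<^bsub>SE\<^esub>\<close>. Uhlmann's theorem gives a pure operator \<open>\<phi>\<close> on \<open>SLEP\<close>, as close
  to the purification \<open>\<psi>\<close> as \<open>\<rho>'\<close> is to \<open>\<rho>\<^bsub>SE\<^esub>\<close>, whose marginal on \<open>SE\<close> is dominated by \<open>\<rho>'\<close> (equality is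
  not needed). Run the protocol on \<open>\<phi>\<close> and discard \<open>P\<close>: by monotonicity of the fidelity and the triangle
  inequality the result is \<open>\<epsilon> + \<delta>\<close> close to \<open>\<rho>\<close>. Its min-entropy is controlled because encoding leaves the
  marginal \<open>\<phi>\<^bsub>SE\<^esub> \<otimes> \<rho>\<^bsub>Y\<^esub>\<close> of \<open>SEY\<close> untouched, and \<open>\<Omega>\<^bsub>QR\<^esub> \<le> |Q|\<^sup>2 (1/|Q|) \<otimes> \<Omega>\<^bsub>R\<^esub>\<close>, respectively
  \<open>\<Omega>\<^bsub>QR\<^esub> \<le> |Q| (1/|Q|) \<otimes> \<Omega>\<^bsub>R\<^esub>\<close> for classical \<open>Q\<close>; the decoder acts on \<open>QEY\<close> alone and preserves the
  inequality. Since \<open>\<rho>\<close> is normalised, the correction term of the generalised fidelity vanishes throughout.\<close>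

section \<open>Algebra of rectangular matrices\<close>

definition qform :: "('a::finite) qop \<Rightarrow> ('a \<Rightarrow> complex) \<Rightarrow> complex" where
  "qform A v = (\<Sum>i\<in>UNIV. \<Sum>j\<in>UNIV. cnj (v i) * A i j * v j)"

text \<open>A single Kraus term. It serves both as a congruence of positive operators and as the
  generator of the completely positive maps \<open>cp\<close>.\<close>

definition sandwich :: "('b, 'a::finite) cmat \<Rightarrow> 'a qop \<Rightarrow> 'b qop" where
  "sandwich K M = mmult (mmult K M) (adjoint K)"

lemma sum_UNIV_prod:
  fixes f :: "('a::finite \<times> 'b::finite) \<Rightarrow> 'c::comm_monoid_add"
  shows "(\<Sum>x\<in>UNIV. f x) = (\<Sum>a\<in>UNIV. \<Sum>b\<in>UNIV. f (a, b))"
  by (simp add: sum.cartesian_product flip: UNIV_Times_UNIV)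

lemma sum_UNIV_sum:
  fixes f :: "('a::finite + 'b::finite) \<Rightarrow> 'c::comm_monoid_add"
  shows "(\<Sum>x\<in>UNIV. f x) = (\<Sum>a\<in>UNIV. f (Inl a)) + (\<Sum>b\<in>UNIV. f (Inr b))"
  by (simp add: sum.Plus flip: UNIV_Plus_UNIV)

lemma mmult_assoc: "mmult (mmult A B) C = mmult A (mmult B C)"
  unfolding mmult_def
  by (intro ext) (simp add: sum_distrib_left sum_distrib_right mult.assoc, rule sum.swap)

lemma adjoint_adjoint [simp]: "adjoint (adjoint A) = A"
  by (simp add: adjoint_def)

lemma adjoint_mmult: "adjoint (mmult A B) = mmult (adjoint B) (adjoint A)"
  by (simp add: adjoint_def mmult_def mult.commute)

lemma adjoint_idm [simp]: "adjoint idm = idm"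
  by (auto simp: adjoint_def idm_def fun_eq_iff)

lemma mmult_idm_left [simp]: "mmult idm A = A"
  by (auto simp: mmult_def idm_def fun_eq_iff if_distrib[of "\<lambda>x. x * _"] cong: if_cong)

lemma mmult_idm_right [simp]: "mmult A idm = A"
  by (auto simp: mmult_def idm_def fun_eq_iff if_distrib[of "\<lambda>x. _ * x"] cong: if_cong)

lemma mmult_add_left: "mmult (\<lambda>i j. A i j + B i j) C = (\<lambda>i j. mmult A C i j + mmult B C i j)"
  by (simp add: mmult_def distrib_right sum.distrib)

lemma mmult_add_right: "mmult C (\<lambda>i j. A i j + B i j) = (\<lambda>i j. mmult C A i j + mmult C B i j)"
  by (simp add: mmult_def distrib_left sum.distrib)

lemma mmult_diff_left: "mmult (\<lambda>i j. A i j - B i j) C = (\<lambda>i j. mmult A C i j - mmult B C i j)"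
  by (simp add: mmult_def left_diff_distrib sum_subtractf)

lemma mmult_diff_right: "mmult C (\<lambda>i j. A i j - B i j) = (\<lambda>i j. mmult C A i j - mmult C B i j)"
  by (simp add: mmult_def right_diff_distrib sum_subtractf)

lemma mmult_scale_left: "mmult (\<lambda>i j. c * A i j) B = (\<lambda>i j. c * mmult A B i j)"
  by (simp add: mmult_def sum_distrib_left mult.assoc)

lemma mmult_scale_right: "mmult B (\<lambda>i j. c * A i j) = (\<lambda>i j. c * mmult B A i j)"
  by (simp add: mmult_def sum_distrib_left mult.left_commute)

lemma mtrace_cyclic: "mtrace (mmult A B) = mtrace (mmult B A)"
  unfolding mtrace_def mmult_def by (subst sum.swap) (simp add: mult.commute)

lemma mtrace_adjoint: "mtrace (adjoint A) = cnj (mtrace A)"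
  by (simp add: mtrace_def adjoint_def)

lemma mtrace_add: "mtrace (\<lambda>i j. A i j + B i j) = mtrace A + mtrace B"
  by (simp add: mtrace_def sum.distrib)

lemma mtrace_diff: "mtrace (\<lambda>i j. A i j - B i j) = mtrace A - mtrace B"
  by (simp add: mtrace_def sum_subtractf)

lemma mtrace_mmult_adjoint:
  "mtrace (mmult A (adjoint B)) = (\<Sum>i\<in>UNIV. \<Sum>j\<in>UNIV. A i j * cnj (B i j))"
  by (simp add: mtrace_def mmult_def adjoint_def)

subsection \<open>Positive operators\<close>

lemma psd_iff: "psd A \<longleftrightarrow> (\<forall>v. Im (qform A v) = 0 \<and> 0 \<le> Re (qform A v))"
  by (simp add: psd_def qform_def complex_is_Real_iff)

lemma qform_add: "qform (\<lambda>i j. A i j + B i j) v = qform A v + qform B v"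
  by (simp add: qform_def algebra_simps sum.distrib)

lemma qform_diff: "qform (\<lambda>i j. A i j - B i j) v = qform A v - qform B v"
  by (simp add: qform_def algebra_simps sum_subtractf)

lemma qform_scale: "qform (\<lambda>i j. c * A i j) v = c * qform A v"
  by (simp add: qform_def algebra_simps sum_distrib_left)

text \<open>A vector is read as a matrix with one column, indexed by \<open>unit\<close>, so that
  quadratic forms inherit associativity and the rules for adjoints.\<close>

lemma qform_eq_mmult:
  "qform A v = mmult (adjoint (\<lambda>i (_::unit). v i)) (mmult A (\<lambda>i _. v i)) () ()"
  by (simp add: qform_def mmult_def adjoint_def sum_distrib_left mult.assoc)

lemma qform_sandwich:
  "qform (sandwich K M) v = qform M (\<lambda>a. \<Sum>i\<in>UNIV. cnj (K i a) * v i)"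
proof -
  have 1: "(\<lambda>a (_::unit). \<Sum>i\<in>UNIV. cnj (K i a) * v i) = mmult (adjoint K) (\<lambda>i _. v i)"
    by (simp add: mmult_def adjoint_def)
  show ?thesis
    unfolding qform_eq_mmult 1 by (simp add: sandwich_def adjoint_mmult mmult_assoc)
qed

lemma psd_add: "psd A \<Longrightarrow> psd B \<Longrightarrow> psd (\<lambda>i j. A i j + B i j)"
  by (simp add: psd_iff qform_add)

lemma psd_scale: "psd A \<Longrightarrow> 0 \<le> c \<Longrightarrow> psd (\<lambda>i j. complex_of_real c * A i j)"
  by (simp add: psd_iff qform_scale)

lemma psd_zero [simp]: "psd (\<lambda>i j. 0)"
  by (simp add: psd_iff qform_def)

lemma psd_sum:
  assumes "\<And>k. k \<in> I \<Longrightarrow> psd (A k)" shows "psd (\<lambda>i j. \<Sum>k\<in>I. A k i j)"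
  using assms by (induction I rule: infinite_finite_induct) (simp_all add: psd_add)

lemma psd_sandwich: "psd M \<Longrightarrow> psd (sandwich K M)"
  by (simp add: psd_iff qform_sandwich)

lemma psd_idm: "psd idm"
proof -
  have "qform idm v = complex_of_real (\<Sum>i\<in>UNIV. (cmod (v i))\<^sup>2)" for v :: "'a \<Rightarrow> complex"
  proof -
    have "cnj (v i) * idm i j * v j = (if i = j then cnj (v i) * v i else 0)" for i j
      by (simp add: idm_def)
    then show ?thesis
      by (simp add: qform_def complex_norm_square mult.commute del: of_real_power)
  qed
  then show ?thesis by (simp add: psd_iff sum_nonneg)
qed

lemma psd_mmult_adjoint: "psd (mmult A (adjoint A))"
  using psd_sandwich[OF psd_idm, of A] by (simp add: sandwich_def)

text \<open>Test vectors supported on two indices suffice to extract entrywise information from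
  positivity: hermiticity, vanishing rows and the bound on the sum of all entries.\<close>

lemma qform_two:
  "qform A (\<lambda>k. (if k = i then 1 else 0) + c * (if k = j then 1 else 0))
     = A i i + cnj c * A j i + c * A i j + cnj c * c * A j j"
proof -
  have d: "(\<Sum>k\<in>UNIV. cnj ((if k = i then 1 else 0) + c * (if k = j then 1 else 0)) * f k)
       = f i + cnj c * f j" for f :: "'a \<Rightarrow> complex"
    by (simp add: distrib_right sum.distrib if_distrib[of cnj] if_distrib[of "\<lambda>x. x * _"]
        if_distrib[of "\<lambda>x. _ * x"] cong: if_cong)
  have d': "(\<Sum>k\<in>UNIV. f k * ((if k = i then 1 else 0) + c * (if k = j then 1 else 0)))
       = f i + c * f j" for f :: "'a \<Rightarrow> complex"
    by (simp add: distrib_left sum.distrib if_distrib[of "\<lambda>x. _ * x"] cong: if_cong)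
  have "qform A (\<lambda>k. (if k = i then 1 else 0) + c * (if k = j then 1 else 0))
     = (\<Sum>k\<in>UNIV. cnj ((if k = i then 1 else 0) + c * (if k = j then 1 else 0)) *
         (\<Sum>l\<in>UNIV. A k l * ((if l = i then 1 else 0) + c * (if l = j then 1 else 0))))"
    unfolding qform_def sum_distrib_left by (simp only: mult.assoc)
  then show ?thesis unfolding d d' by (simp add: algebra_simps)
qed

lemma psd_hermitian:
  assumes "psd A" shows "adjoint A = A"
proof -
  have q: "Im (A i i + cnj c * A j i + c * A i j + cnj c * c * A j j) = 0" for i j c
    using assms unfolding psd_iff qform_two[symmetric] by blast
  have im: "Im (A i i) = 0" for i using q[of i 0 i] by simp
  have "cnj (A j i) = A i j" for i j
    \<comment> \<open>The choice \<open>c = 1\<close> makes the imaginary parts of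
      \<open>A i j\<close> and \<open>A j i\<close> opposite, and \<open>c = \<i>\<close> makes
      their real parts equal.\<close>
    using q[of i 1 j] q[of i \<i> j] im[of i] im[of j]
    by (auto simp: complex_eq_iff)
  then show ?thesis by (simp add: adjoint_def)
qed

lemma psd_diag:
  assumes "psd A" shows "Im (A i i) = 0" "0 \<le> Re (A i i)"
proof -
  have "qform A (\<lambda>k. if k = i then 1 else 0) = A i i" using qform_two[of A i 0 i] by simp
  then show "Im (A i i) = 0" "0 \<le> Re (A i i)" using assms unfolding psd_iff by metis+
qed

text \<open>When the diagonal entry at \<open>x\<close> vanishes, the form at
  \<open>e_j + c e_x\<close> has no quadratic term in \<open>c\<close>; a nonzero
  \<open>A j x\<close> would let it become negative.\<close>

lemma psd_zero_diag:
  assumes A: "psd A" and 0: "A x x = 0" shows "A j x = 0" "A x j = 0"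
proof -
  show *: "A j x = 0"
  proof (rule ccontr)
    assume n: "A j x \<noteq> 0"
    \<comment> \<open>Chosen so that \<open>c * A j x = - (A j j + 1)\<close>, which makes the form
      equal to \<open>- A j j - 2\<close>.\<close>
    define c where "c = - complex_of_real (Re (A j j) + 1) * cnj (A j x) / complex_of_real ((cmod (A j x))\<^sup>2)"
    have cA: "c * A j x = - complex_of_real (Re (A j j) + 1)"
      using n by (simp add: c_def complex_norm_square field_simps del: of_real_power)
    have h: "A x j = cnj (A j x)" using psd_hermitian[OF A] by (metis adjoint_def)
    have "cnj c * A x j = - complex_of_real (Re (A j j) + 1)"
      using arg_cong[OF cA, of cnj] by (simp add: h)
    moreover have "0 \<le> Re (A j j + cnj c * A x j + c * A j x + cnj c * c * A x x)"
      using A unfolding psd_iff qform_two[symmetric] by blast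
    ultimately show False using psd_diag(2)[OF A, of j] by (simp add: cA 0)
  qed
  show "A x j = 0" using * psd_hermitian[OF A] by (metis adjoint_def complex_cnj_zero)
qed

section \<open>Elimination and rank-one decompositions\<close>

text \<open>Eliminating the pivot \<open>x\<close> is a congruence, by the identity minus column
  \<open>x\<close> of \<open>A\<close> divided by the pivot and placed in column \<open>x\<close>.
  Congruences preserve positivity.\<close>

lemma psd_schur_complement:
  assumes A: "psd A" and n: "A x x \<noteq> 0"
  shows "psd (\<lambda>i j. A i j - A i x * A x j / A x x)"
proof -
  define K where "K = (\<lambda>i j. (if i = j then 1 else 0) - (if j = x then A i x / A x x else 0))"
  have h: "cnj (A i j) = A j i" for i j using psd_hermitian[OF A] by (metis adjoint_def)
  have 1: "mmult K A = (\<lambda>i j. A i j - A i x * A x j / A x x)"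
    by (auto simp: mmult_def K_def fun_eq_iff left_diff_distrib sum_subtractf
        if_distrib[of "\<lambda>x. x * _"] cong: if_cong)
  \<comment> \<open>Column \<open>x\<close> of \<open>mmult K A\<close> vanishes, so the
    multiplication by \<open>adjoint K\<close> from the right changes nothing.\<close>
  have "sandwich K A = (\<lambda>i j. A i j - A i x * A x j / A x x)"
    unfolding sandwich_def 1 unfolding mmult_def adjoint_def K_def using n
    by (auto simp: fun_eq_iff right_diff_distrib sum_subtractf if_distrib[of cnj]
        if_distrib[of "\<lambda>x. _ * x"] cong: if_cong)
  then show ?thesis using psd_sandwich[OF A] by metis
qed

text \<open>Cholesky elimination, one index of the support at a time.\<close>
lemma psd_rank_one_sum_on:
  assumes "finite S" "psd B" "\<And>i j. B i j \<noteq> 0 \<Longrightarrow> i \<in> S \<and> j \<in> S"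
  shows "\<exists>w. B = (\<lambda>i j. \<Sum>k\<in>S. w k i * cnj (w k j))"
  using assms
proof (induction S arbitrary: B rule: finite_induct)
  case empty
  then have "B = (\<lambda>i j. 0)" by (intro ext) blast
  then show ?case by simp
next
  case (insert x S)
  have h: "cnj (B i j) = B j i" for i j using psd_hermitian[OF insert.prems(1)] by (metis adjoint_def)
  show ?case
  proof (cases "B x x = 0")
    case True
    have "i \<in> S \<and> j \<in> S" if "B i j \<noteq> 0" for i j
      using insert.prems(2)[OF that] that psd_zero_diag[OF insert.prems(1) True] by auto
    from insert.IH[OF insert.prems(1) this] obtain w where
      w: "B = (\<lambda>i j. \<Sum>k\<in>S. w k i * cnj (w k j))" by blast
    \<comment> \<open>With a zero pivot the whole row and column vanish, so \<open>x\<close>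
      contributes the zero vector.\<close>
    have "(\<Sum>k\<in>insert x S. (w(x := \<lambda>_. 0)) k i * cnj ((w(x := \<lambda>_. 0)) k j)) = B i j" for i j
    proof -
      have "(\<Sum>k\<in>S. (w(x := \<lambda>_. 0)) k i * cnj ((w(x := \<lambda>_. 0)) k j)) = (\<Sum>k\<in>S. w k i * cnj (w k j))"
        by (rule sum.cong) (use insert.hyps in auto)
      then show ?thesis using insert.hyps fun_cong[OF fun_cong[OF w], of i j] by simp
    qed
    then have "B = (\<lambda>i j. \<Sum>k\<in>insert x S. (w(x := \<lambda>_. 0)) k i * cnj ((w(x := \<lambda>_. 0)) k j))"
      by (intro ext) (rule sym)
    then show ?thesis by blast
  next
    case False
    define b where "b = Re (B x x)"
    have Bx: "B x x = complex_of_real b" using psd_diag(1)[OF insert.prems(1), of x]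
      by (simp add: b_def complex_eq_iff)
    have "b \<noteq> 0" using False unfolding Bx by simp
    moreover have "0 \<le> b" unfolding b_def by (rule psd_diag(2)[OF insert.prems(1)])
    ultimately have b: "b > 0" by simp
    let ?B = "\<lambda>i j. B i j - B i x * B x j / B x x"
    have "i \<in> S \<and> j \<in> S" if "?B i j \<noteq> 0" for i j
    proof -
      have "i \<noteq> x" "j \<noteq> x" using that False by auto
      moreover have "B i j \<noteq> 0 \<or> B i x \<noteq> 0 \<and> B x j \<noteq> 0" using that by auto
      then have "i \<in> insert x S \<and> j \<in> insert x S" using insert.prems(2) by blast
      ultimately show ?thesis by auto
    qed
    from insert.IH[OF psd_schur_complement[OF insert.prems(1) False] this] obtain w where
      w: "?B = (\<lambda>i j. \<Sum>k\<in>S. w k i * cnj (w k j))" by blast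
    \<comment> \<open>The term subtracted in the elimination is itself of rank one: it comes from
      column \<open>x\<close> divided by the root of the pivot.\<close>
    define u where "u = w(x := \<lambda>i. B i x / complex_of_real (sqrt b))"
    have "(\<Sum>k\<in>insert x S. u k i * cnj (u k j)) = B i j" for i j
    proof -
      have "(\<Sum>k\<in>S. u k i * cnj (u k j)) = (\<Sum>k\<in>S. w k i * cnj (w k j))"
        by (rule sum.cong) (use insert.hyps in \<open>auto simp: u_def\<close>)
      moreover have "u x i * cnj (u x j) = B i x * B x j / B x x"
        using b by (simp add: u_def h Bx flip: of_real_mult)
      ultimately show ?thesis using insert.hyps fun_cong[OF fun_cong[OF w], of i j, symmetric] by simp
    qed
    then have "B = (\<lambda>i j. \<Sum>k\<in>insert x S. u k i * cnj (u k j))"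
      by (intro ext) (rule sym)
    then show ?thesis by blast
  qed
qed

lemma psd_rank_one_sum:
  fixes B :: "('a::finite) qop"
  assumes "psd B" shows "\<exists>w :: 'a \<Rightarrow> 'a \<Rightarrow> complex. B = (\<lambda>i j. \<Sum>k\<in>UNIV. w k i * cnj (w k j))"
  using psd_rank_one_sum_on[of UNIV B] assms by simp

lemma psd_factor:
  fixes B :: "('a::finite) qop"
  assumes "psd B" shows "\<exists>A :: 'a qop. B = mmult A (adjoint A)"
proof -
  obtain w :: "'a \<Rightarrow> 'a \<Rightarrow> complex" where "B = (\<lambda>i j. \<Sum>k\<in>UNIV. w k i * cnj (w k j))"
    using psd_rank_one_sum[OF assms] by blast
  then have "B = mmult (\<lambda>i k. w k i) (adjoint (\<lambda>i k. w k i))"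
    by (simp add: mmult_def adjoint_def)
  then show ?thesis by blast
qed

subsection \<open>Polar decomposition and square roots\<close>

definition unitarym :: "('a::finite) qop \<Rightarrow> bool" where
  "unitarym U \<longleftrightarrow> mmult U (adjoint U) = idm \<and> mmult (adjoint U) U = idm"

lemma unitarym_idm: "unitarym idm"
  by (simp add: unitarym_def)

lemma unitarym_adjoint: "unitarym U \<Longrightarrow> unitarym (adjoint U)"
  by (simp add: unitarym_def)

lemma unitarym_mmult:
  assumes "unitarym U" "unitarym V" shows "unitarym (mmult U V)"
proof -
  have "mmult (mmult U V) (adjoint (mmult U V)) = mmult U (mmult (mmult V (adjoint V)) (adjoint U))"
    by (simp add: adjoint_mmult mmult_assoc)
  moreover have "mmult (adjoint (mmult U V)) (mmult U V) = mmult (adjoint V) (mmult (mmult (adjoint U) U) V)"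
    by (simp add: adjoint_mmult mmult_assoc)
  ultimately show ?thesis using assms by (simp add: unitarym_def)
qed

lemma unitarym_row_sum:
  assumes "unitarym U" shows "(\<Sum>j\<in>UNIV. (cmod (U i j))\<^sup>2) = 1"
proof -
  have "mmult U (adjoint U) i i = 1" using assms by (simp add: unitarym_def idm_def)
  then have "complex_of_real (\<Sum>j\<in>UNIV. (cmod (U i j))\<^sup>2) = 1"
    by (simp add: mmult_def adjoint_def complex_norm_square del: of_real_power)
  then show ?thesis by (metis of_real_eq_1_iff)
qed

lemma unitarym_entry_le: "unitarym U \<Longrightarrow> cmod (U i j) \<le> 1"
  using member_le_sum[of j UNIV "\<lambda>j. (cmod (U i j))\<^sup>2"] unitarym_row_sum[of U i]
  by (simp add: abs_square_le_1[of "cmod _", simplified])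

text \<open>The unitary group is compact and the objective continuous. The matrices are moved to
  \<open>complex^'a^'a\<close>, where closed and bounded sets are compact.\<close>

lemma unitarym_maximiser:
  fixes A :: "('a::finite) qop"
  shows "\<exists>U. unitarym U \<and> (\<forall>V. unitarym V \<longrightarrow> Re (mtrace (mmult V A)) \<le> Re (mtrace (mmult U A)))"
proof -
  define C where "C = {M :: complex^'a^'a. unitarym (\<lambda>i j. M $ i $ j)}"
  have "C = (\<Inter>i. \<Inter>j. {M. (\<Sum>k\<in>UNIV. M $ i $ k * cnj (M $ j $ k)) = idm i j}) \<inter>
        (\<Inter>i. \<Inter>j. {M. (\<Sum>k\<in>UNIV. cnj (M $ k $ i) * M $ k $ j) = idm i j})"
    by (auto simp: C_def unitarym_def mmult_def adjoint_def fun_eq_iff)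
  moreover have "closed {M :: complex^'a^'a. (\<Sum>k\<in>UNIV. M $ i $ k * cnj (M $ j $ k)) = idm i j}" for i j
    by (intro closed_Collect_eq continuous_intros)
  moreover have "closed {M :: complex^'a^'a. (\<Sum>k\<in>UNIV. cnj (M $ k $ i) * M $ k $ j) = idm i j}" for i j
    by (intro closed_Collect_eq continuous_intros)
  ultimately have "closed C" by (auto intro!: closed_Int closed_INT)
  moreover have "bounded C"
  proof (rule boundedI)
    fix M assume "M \<in> C"
    then have M: "cmod (M $ i $ j) \<le> 1" for i j
      using unitarym_entry_le[of "\<lambda>i j. M $ i $ j"] by (simp add: C_def)
    have "norm (M $ i) \<le> real CARD('a)" for i
    proof -
      have "norm (M $ i) \<le> (\<Sum>j\<in>UNIV. norm (M $ i $ j))"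
        by (simp add: norm_vec_def L2_set_le_sum)
      also have "\<dots> \<le> (\<Sum>j\<in>(UNIV::'a set). 1)" by (intro sum_mono) (rule M)
      finally show ?thesis by simp
    qed
    then have "(\<Sum>i\<in>UNIV. norm (M $ i)) \<le> (\<Sum>i\<in>(UNIV::'a set). real CARD('a))"
      by (intro sum_mono)
    moreover have "norm M \<le> (\<Sum>i\<in>UNIV. norm (M $ i))"
      by (subst norm_vec_def) (simp add: L2_set_le_sum)
    ultimately show "norm M \<le> real CARD('a) * real CARD('a)" by simp
  qed
  ultimately have C: "compact C" by (simp add: compact_eq_bounded_closed)
  have ne: "(\<chi> i j. idm i j) \<in> C"
  proof -
    have "(\<lambda>i j. (\<chi> i j. idm i j) $ i $ j) = (idm :: 'a qop)" by (intro ext) simp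
    then show ?thesis
      unfolding C_def mem_Collect_eq by (rule back_subst[of unitarym, OF unitarym_idm, OF sym])
  qed
  have cont: "continuous_on C (\<lambda>M. Re (mtrace (mmult (\<lambda>i j. M $ i $ j) A)))"
    unfolding mtrace_def mmult_def by (intro continuous_intros)
  obtain M where M: "M \<in> C" and
    max: "\<And>N. N \<in> C \<Longrightarrow> Re (mtrace (mmult (\<lambda>i j. N $ i $ j) A)) \<le> Re (mtrace (mmult (\<lambda>i j. M $ i $ j) A))"
    using continuous_attains_sup[OF C _ cont] ne by blast
  show ?thesis
  proof (intro exI[of _ "\<lambda>i j. M $ i $ j"] conjI allI impI)
    show "unitarym (\<lambda>i j. M $ i $ j)" using M by (simp add: C_def)
    fix V :: "'a qop" assume "unitarym V"
    then show "Re (mtrace (mmult V A)) \<le> Re (mtrace (mmult (\<lambda>i j. M $ i $ j) A))"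
    proof -
      have "(\<lambda>i j. (\<chi> i j. V i j) $ i $ j) = V" by (intro ext) simp
      moreover from this have "(\<chi> i j. V i j) \<in> C"
        unfolding C_def mem_Collect_eq by (rule back_subst[of unitarym, OF \<open>unitarym V\<close>, OF sym])
      ultimately show ?thesis using max[of "\<chi> i j. V i j"] by (simp only:)
    qed
  qed
qed


text \<open>The operator multiplies the direction \<open>v\<close> by \<open>1 + c\<close> and fixes
  its orthogonal complement; the condition on \<open>c\<close> says that \<open>1 + c\<close> has
  modulus one.\<close>

lemma unitarym_phase:
  fixes v :: "'a::finite \<Rightarrow> complex"
  assumes v: "(\<Sum>i\<in>UNIV. (cmod (v i))\<^sup>2) = 1" and c: "c + cnj c + c * cnj c = 0"
  shows "unitarym (\<lambda>i j. idm i j + c * ketbra v i j)"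
proof -
  let ?K = "ketbra v"
  have vv: "(\<Sum>i\<in>UNIV. v i * cnj (v i)) = 1"
    using v unfolding complex_norm_square[symmetric] of_real_sum[symmetric] by simp
  have K: "mmult ?K ?K = ?K"
  proof (intro ext)
    fix i k
    have "mmult ?K ?K i k = v i * (\<Sum>j\<in>UNIV. v j * cnj (v j)) * cnj (v k)"
      by (simp add: mmult_def ketbra_def sum_distrib_left sum_distrib_right mult_ac)
    then show "mmult ?K ?K i k = ?K i k" by (simp add: vv ketbra_def)
  qed
  have adj: "adjoint (\<lambda>i j. idm i j + c * ?K i j) = (\<lambda>i j. idm i j + cnj c * ?K i j)"
    by (auto simp: adjoint_def idm_def ketbra_def fun_eq_iff)
  have "mmult (\<lambda>i j. idm i j + a * ?K i j) (\<lambda>i j. idm i j + b * ?K i j)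
      = (\<lambda>i j. idm i j + (a + b + a * b) * ?K i j)" for a b
    by (simp add: mmult_add_left mmult_add_right mmult_scale_left mmult_scale_right K algebra_simps)
  moreover have "cnj c + c + cnj c * c = 0" using c by (simp add: add.commute mult.commute)
  ultimately show ?thesis unfolding unitarym_def adj using c by simp
qed

lemma mtrace_mmult_ketbra: "mtrace (mmult (ketbra v) A) = qform A v"
proof -
  have "mtrace (mmult (ketbra v) A) = (\<Sum>i\<in>UNIV. \<Sum>j\<in>UNIV. v i * cnj (v j) * A j i)"
    by (simp add: mtrace_def mmult_def ketbra_def)
  also have "\<dots> = qform A v"
    unfolding qform_def by (subst sum.swap) (simp add: mult_ac)
  finally show ?thesis .
qed

lemma psd_of_maximal_trace:
  fixes P :: "('a::finite) qop"
  assumes max: "\<And>V. unitarym V \<Longrightarrow> Re (mtrace (mmult V P)) \<le> Re (mtrace P)"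
  shows "psd P"
proof -
  have unit: "qform P v = complex_of_real (cmod (qform P v))"
    if v: "(\<Sum>i\<in>UNIV. (cmod (v i))\<^sup>2) = 1" for v
  proof (cases "qform P v = 0")
    case False
    define z where "z = qform P v"
    \<comment> \<open>The factor \<open>1 + c\<close> is the phase that turns \<open>z\<close> into
      its modulus. The rotation would gain \<open>cmod z - Re z\<close>, so maximality forces
      \<open>z\<close> to be real and nonnegative.\<close>
    define c where "c = cnj z / cmod z - 1"
    have z: "cmod z > 0" using False by (simp add: z_def)
    have zz: "z * cnj z = complex_of_real (cmod z) * complex_of_real (cmod z)"
      by (metis complex_norm_square of_real_mult power2_eq_square)
    have "(c + 1) * cnj (c + 1) = 1"
      using z zz by (simp add: c_def mult.commute)
    then have "c + cnj c + c * cnj c = 0" by (simp add: algebra_simps)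
    from max[OF unitarym_phase[OF v this]]
    have "Re (c * z) \<le> 0"
      by (simp add: mmult_add_left mmult_scale_left mtrace_add mtrace_mmult_ketbra z_def
          mtrace_def sum_distrib_left[symmetric] mtrace_mmult_ketbra[unfolded mtrace_def])
    moreover have "c * z = complex_of_real (cmod z) - z"
    proof -
      have "c * z = (z * cnj z) / complex_of_real (cmod z) - z" by (simp add: c_def algebra_simps)
      then show ?thesis using z unfolding zz by simp
    qed
    ultimately have "cmod z \<le> Re z" by simp
    moreover have "Re z \<le> cmod z" by (rule complex_Re_le_cmod)
    ultimately have "Re z = cmod z" by simp
    then show ?thesis unfolding z_def[symmetric]
      by (metis cmod_eq_Re complex_eq_iff complex_of_real_code cmod_power2 Im_complex_of_real Re_complex_of_real add_cancel_left_right zero_eq_power2)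
  qed simp
  show ?thesis unfolding psd_iff
  proof
    fix v :: "'a \<Rightarrow> complex"
    define N where "N = (\<Sum>i\<in>UNIV. (cmod (v i))\<^sup>2)"
    show "Im (qform P v) = 0 \<and> 0 \<le> Re (qform P v)"
    proof (cases "N = 0")
      case True
      then have "v i = 0" for i unfolding N_def by (subst (asm) sum_nonneg_eq_0_iff) auto
      then show ?thesis by (simp add: qform_def)
    next
      case False
      moreover have "N \<ge> 0" unfolding N_def by (simp add: sum_nonneg)
      ultimately have N: "N > 0" by simp
      define w where "w = (\<lambda>i. v i / complex_of_real (sqrt N))"
      have "(\<Sum>i\<in>UNIV. (cmod (w i))\<^sup>2) = 1"
        using N by (simp add: w_def norm_divide power_divide flip: sum_divide_distrib N_def)
      note u = unit[OF this]
      have v: "v = (\<lambda>i. complex_of_real (sqrt N) * w i)" using N by (simp add: w_def)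
      have "qform P v = complex_of_real N * qform P w"
      proof -
        have "complex_of_real N = complex_of_real (sqrt N) * complex_of_real (sqrt N)"
          using N by (simp flip: of_real_mult)
        then show ?thesis unfolding v qform_def by (simp add: sum_distrib_left mult_ac)
      qed
      then have "qform P v = complex_of_real (N * cmod (qform P w))" by (subst (asm) u) simp
      then show ?thesis using N by simp
    qed
  qed
qed

text \<open>A unitary maximising \<open>Re (tr (U A))\<close> makes \<open>U A\<close> positive: otherwise rotating the phase of
  a single direction would increase the trace. This gives polar decompositions, hence square roots,
  without any spectral theory.\<close>
lemma polar_decomposition:
  fixes A :: "('a::finite) qop"
  obtains U where "unitarym U" "psd (mmult U A)"
    "\<And>V. unitarym V \<Longrightarrow> Re (mtrace (mmult V A)) \<le> Re (mtrace (mmult U A))"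
proof -
  obtain U where U: "unitarym U"
    and max: "\<And>V. unitarym V \<Longrightarrow> Re (mtrace (mmult V A)) \<le> Re (mtrace (mmult U A))"
    using unitarym_maximiser[of A] by blast
  have "psd (mmult U A)"
  proof (rule psd_of_maximal_trace)
    fix V :: "'a qop" assume "unitarym V"
    then show "Re (mtrace (mmult V (mmult U A))) \<le> Re (mtrace (mmult U A))"
      using max[OF unitarym_mmult[OF _ U]] by (simp add: mmult_assoc)
  qed
  with U max show ?thesis using that by blast
qed

lemma mtrace_mmult_adjoint_self:
  "mtrace (mmult A (adjoint A)) = complex_of_real (\<Sum>i\<in>UNIV. \<Sum>j\<in>UNIV. (cmod (A i j))\<^sup>2)"
  by (simp add: mtrace_mmult_adjoint complex_norm_square del: of_real_power)

lemma mtrace_mmult_adjoint_self_0: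
  assumes "Re (mtrace (mmult A (adjoint A))) = 0" shows "A = (\<lambda>i j. 0)"
proof (intro ext)
  fix i j
  have 0: "(\<Sum>i\<in>UNIV. \<Sum>j\<in>UNIV. (cmod (A i j))\<^sup>2) = 0"
    using assms unfolding mtrace_mmult_adjoint_self by simp
  then have "(\<Sum>j\<in>UNIV. (cmod (A i j))\<^sup>2) = 0"
    by (subst (asm) sum_nonneg_eq_0_iff) (simp_all add: sum_nonneg)
  then show "A i j = 0" by (subst (asm) sum_nonneg_eq_0_iff) simp_all
qed

text \<open>Write \<open>B\<close> as \<open>A\<close> times its adjoint and let \<open>U\<close>
  make \<open>P\<close>, the product of \<open>U\<close> and \<open>adjoint A\<close>, positive. As
  \<open>P\<close> is hermitian, its square is \<open>adjoint P\<close> times \<open>P\<close>,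
  where \<open>U\<close> cancels and \<open>B\<close> remains.\<close>

lemma psd_sqrt_exists:
  fixes B :: "('a::finite) qop"
  assumes "psd B" shows "\<exists>C. psd C \<and> mmult C C = B"
proof -
  obtain A :: "'a qop" where A: "B = mmult A (adjoint A)" using psd_factor[OF assms] by blast
  obtain U where U: "unitarym U" and P: "psd (mmult U (adjoint A))"
    using polar_decomposition[of "adjoint A"] by blast
  have "mmult (mmult U (adjoint A)) (mmult U (adjoint A))
      = mmult (adjoint (mmult U (adjoint A))) (mmult U (adjoint A))"
    by (simp only: psd_hermitian[OF P])
  also have "\<dots> = mmult A (mmult (mmult (adjoint U) U) (adjoint A))"
    by (simp add: adjoint_mmult mmult_assoc)
  also have "\<dots> = B" using U by (simp add: unitarym_def A)
  finally show ?thesis using P by blast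
qed

text \<open>With \<open>D = B - C\<close>, equal squares give \<open>B D + D C = 0\<close>.
  Multiplying by \<open>D\<close> and taking the trace yields a vanishing sum of two squared
  Hilbert-Schmidt norms, those of \<open>D G\<close> and \<open>D H\<close> for factors
  \<open>G\<close> of \<open>B\<close> and \<open>H\<close> of \<open>C\<close>. Hence
  \<open>D B = D C = 0\<close>, so \<open>D D = 0\<close> and \<open>D = 0\<close>.\<close>

lemma psd_sqrt_unique:
  fixes B C :: "('a::finite) qop"
  assumes B: "psd B" and C: "psd C" and eq: "mmult B B = mmult C C"
  shows "B = C"
proof -
  define D where "D = (\<lambda>i j. B i j - C i j)"
  have D: "adjoint D = D"
    using psd_hermitian[OF B] psd_hermitian[OF C] by (simp add: D_def adjoint_def fun_eq_iff)
  obtain G :: "'a qop" where G: "B = mmult G (adjoint G)" using psd_factor[OF B] by blast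
  obtain H :: "'a qop" where H: "C = mmult H (adjoint H)" using psd_factor[OF C] by blast
  have t: "mtrace (mmult D (mmult (mmult X (adjoint X)) D)) = mtrace (mmult (mmult D X) (adjoint (mmult D X)))"
    for X :: "'a qop"
    by (simp add: adjoint_mmult D mmult_assoc)
  have "(\<lambda>i j. mmult B D i j + mmult D C i j) = (\<lambda>i j. 0)"
    by (simp add: D_def mmult_diff_left mmult_diff_right eq)
  then have "mmult D (\<lambda>i j. mmult B D i j + mmult D C i j) = (\<lambda>i j. 0)"
    by (simp add: mmult_def)
  then have "mtrace (\<lambda>i j. mmult D (mmult B D) i j + mmult D (mmult D C) i j) = 0"
    unfolding mmult_add_right by (simp add: mtrace_def)
  then have "mtrace (mmult D (mmult B D)) + mtrace (mmult D (mmult C D)) = 0"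
    unfolding mtrace_add using mtrace_cyclic[of D "mmult D C"] by (simp add: mmult_assoc)
  then have "Re (mtrace (mmult (mmult D G) (adjoint (mmult D G))))
      + Re (mtrace (mmult (mmult D H) (adjoint (mmult D H)))) = 0"
    unfolding t[symmetric] G[symmetric] H[symmetric] by (simp add: complex_eq_iff)
  moreover have "0 \<le> Re (mtrace (mmult X (adjoint X)))" for X :: "'a qop"
    unfolding mtrace_mmult_adjoint_self by (simp add: sum_nonneg)
  ultimately have "mmult D G = (\<lambda>i j. 0)" "mmult D H = (\<lambda>i j. 0)"
    by (metis add_nonneg_eq_0_iff mtrace_mmult_adjoint_self_0)+
  then have "mmult D B = (\<lambda>i j. 0)" "mmult D C = (\<lambda>i j. 0)"
    unfolding G H mmult_assoc[symmetric] by (simp_all add: mmult_def)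
  then have "mmult D D = (\<lambda>i j. 0)" by (subst (2) D_def) (simp add: mmult_diff_right)
  then have "mmult D (adjoint D) = (\<lambda>i j. 0)" by (simp add: D)
  then have "Re (mtrace (mmult D (adjoint D))) = 0" by (simp add: mtrace_def)
  from mtrace_mmult_adjoint_self_0[OF this] show ?thesis by (simp add: D_def fun_eq_iff)
qed

lemma sqrtm_eqI: "psd B \<Longrightarrow> mmult B B = A \<Longrightarrow> sqrtm A = B"
  unfolding sqrtm_def by (rule the_equality) (auto intro: psd_sqrt_unique)

lemma psd_sqrtm: "psd A \<Longrightarrow> psd (sqrtm A)"
  and mmult_sqrtm: "psd A \<Longrightarrow> mmult (sqrtm A) (sqrtm A) = A"
  using psd_sqrt_exists[of A] sqrtm_eqI by metis+

text \<open>The variational formula for the trace norm: the positive operator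
  \<open>mmult U M\<close> from the polar decomposition squares to
  \<open>mmult (adjoint M) M\<close>, so it is the root whose trace defines the norm.\<close>

lemma trace_norm_attained:
  fixes M :: "('a::finite) qop"
  obtains U where "unitarym U" "trace_norm M = Re (mtrace (mmult U M))"
    "\<And>V. unitarym V \<Longrightarrow> Re (mtrace (mmult V M)) \<le> trace_norm M"
proof -
  obtain U where U: "unitarym U" and P: "psd (mmult U M)"
    and max: "\<And>V. unitarym V \<Longrightarrow> Re (mtrace (mmult V M)) \<le> Re (mtrace (mmult U M))"
    using polar_decomposition[of M] by blast
  have "mmult (mmult U M) (mmult U M) = mmult (adjoint (mmult U M)) (mmult U M)"
    by (simp only: psd_hermitian[OF P])
  also have "\<dots> = mmult (adjoint M) (mmult (mmult (adjoint U) U) M)"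
    by (simp add: adjoint_mmult mmult_assoc)
  also have "\<dots> = mmult (adjoint M) M" using U by (simp add: unitarym_def)
  finally have "sqrtm (mmult (adjoint M) M) = mmult U M" using sqrtm_eqI[OF P] by blast
  then have "trace_norm M = Re (mtrace (mmult U M))" by (simp add: trace_norm_def)
  with U max show ?thesis using that by simp
qed

subsection \<open>Fidelity\<close>

text \<open>The generalised fidelity without its correction term, which is zero as soon as one
  argument has trace one.\<close>

definition fid :: "('a::finite) qop \<Rightarrow> 'a qop \<Rightarrow> real" where
  "fid \<rho> \<sigma> = trace_norm (mmult (sqrtm \<rho>) (sqrtm \<sigma>))"

text \<open>Any square factor of a positive operator differs from the root by a unitary. This
  reduces statements about purifications to statements about roots.\<close>

lemma left_polar_decomposition:
  fixes A :: "('a::finite) qop"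
  obtains U where "unitarym U" "A = mmult (sqrtm (mmult A (adjoint A))) U"
proof -
  obtain U where U: "unitarym U" and P: "psd (mmult U (adjoint A))"
    by (rule polar_decomposition)
  have P': "mmult U (adjoint A) = mmult A (adjoint U)"
    using psd_hermitian[OF P] by (simp add: adjoint_mmult)
  have "mmult (mmult A (adjoint U)) (mmult U (adjoint A)) = mmult A (mmult (mmult (adjoint U) U) (adjoint A))"
    by (simp add: mmult_assoc)
  then have "sqrtm (mmult A (adjoint A)) = mmult A (adjoint U)"
    using U P by (intro sqrtm_eqI) (simp_all add: P' unitarym_def)
  moreover have "mmult (mmult A (adjoint U)) U = A" using U by (simp add: mmult_assoc unitarym_def)
  ultimately show ?thesis using that[OF U] by simp
qed

text \<open>The easy half of Uhlmann's theorem: after polar decomposition the overlap of the factors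
  is the trace of a unitary times the product of the roots, hence a competitor in the variational
  formula.\<close>

lemma fid_ge_square:
  fixes A B :: "('a::finite) qop"
  shows "Re (mtrace (mmult A (adjoint B))) \<le> fid (mmult A (adjoint A)) (mmult B (adjoint B))"
proof -
  let ?r = "sqrtm (mmult A (adjoint A))" and ?s = "sqrtm (mmult B (adjoint B))"
  obtain U where U: "unitarym U" "A = mmult ?r U" by (rule left_polar_decomposition)
  obtain W where W: "unitarym W" "B = mmult ?s W" by (rule left_polar_decomposition)
  have r: "adjoint ?r = ?r" "adjoint ?s = ?s"
    by (simp_all add: psd_hermitian psd_sqrtm psd_mmult_adjoint)
  have Z: "Re (mtrace (mmult V (mmult ?r ?s))) \<le> trace_norm (mmult ?r ?s)" if "unitarym V" for V
    using trace_norm_attained that by metis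
  have "mtrace (mmult B (adjoint A)) = mtrace (mmult (mmult ?s W) (adjoint (mmult ?r U)))"
    using U(2) W(2) by metis
  also have "\<dots> = mtrace (mmult ?s (mmult W (mmult (adjoint U) ?r)))"
    by (simp add: adjoint_mmult r mmult_assoc)
  also have "\<dots> = mtrace (mmult (mmult W (adjoint U)) (mmult ?r ?s))"
    using mtrace_cyclic[of ?s] by (simp add: mmult_assoc)
  finally have e: "mtrace (mmult B (adjoint A)) = mtrace (mmult (mmult W (adjoint U)) (mmult ?r ?s))" .
  have "Re (mtrace (mmult A (adjoint B))) = Re (mtrace (mmult B (adjoint A)))"
    using mtrace_adjoint[of "mmult B (adjoint A)"] by (simp add: adjoint_mmult)
  also have "\<dots> \<le> trace_norm (mmult ?r ?s)"
    unfolding e using Z unitarym_mmult unitarym_adjoint U W by blast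
  finally show ?thesis by (simp add: fid_def)
qed

lemma fid_attained_square:
  fixes A \<sigma> :: "('a::finite) qop"
  assumes s: "psd \<sigma>"
  obtains B where "mmult B (adjoint B) = \<sigma>" "fid \<sigma> (mmult A (adjoint A)) = Re (mtrace (mmult A (adjoint B)))"
proof -
  let ?r = "sqrtm (mmult A (adjoint A))" and ?s = "sqrtm \<sigma>"
  obtain U where U: "unitarym U" "A = mmult ?r U" by (rule left_polar_decomposition)
  obtain W where W: "unitarym W" "trace_norm (mmult ?s ?r) = Re (mtrace (mmult W (mmult ?s ?r)))"
    by (rule trace_norm_attained)
  have r: "adjoint ?s = ?s" by (simp add: psd_hermitian psd_sqrtm s)
  \<comment> \<open>In the overlap with \<open>A\<close> the phase \<open>U\<close> of
    \<open>A\<close> cancels, and the unitary \<open>W\<close> that attains the trace norm is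
    left.\<close>
  define B where "B = mmult ?s (mmult (adjoint W) U)"
  have "mmult B (adjoint B) = mmult ?s (mmult (adjoint W) (mmult (mmult U (adjoint U)) (mmult W ?s)))"
    by (simp add: B_def adjoint_mmult r mmult_assoc)
  also have "\<dots> = mmult ?s (mmult (mmult (adjoint W) W) ?s)"
    using U by (simp add: mmult_assoc unitarym_def)
  also have "\<dots> = \<sigma>" using W by (simp add: unitarym_def mmult_sqrtm s)
  finally have 1: "mmult B (adjoint B) = \<sigma>" .
  have "mmult A (adjoint B) = mmult (mmult ?r U) (adjoint B)" using U(2) by metis
  also have "\<dots> = mmult ?r (mmult (mmult U (adjoint U)) (mmult W ?s))"
    by (simp add: B_def adjoint_mmult r mmult_assoc)
  also have "\<dots> = mmult ?r (mmult W ?s)" using U by (simp add: unitarym_def)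
  finally have "mtrace (mmult A (adjoint B)) = mtrace (mmult W (mmult ?s ?r))"
    using mtrace_cyclic[of ?r "mmult W ?s"] by (simp add: mmult_assoc)
  with 1 W that show ?thesis by (simp add: fid_def)
qed

section \<open>Invariance under isometries, and Uhlmann's theorem for rectangular factors\<close>

lemma sandwich_isometry_mmult:
  assumes "mmult (adjoint J) J = idm"
  shows "mmult (sandwich J A) (sandwich J B) = sandwich J (mmult A B)"
proof -
  have "mmult (sandwich J A) (sandwich J B)
      = mmult (mmult J A) (mmult (mmult (adjoint J) J) (mmult B (adjoint J)))"
    by (simp add: sandwich_def mmult_assoc)
  then show ?thesis by (simp add: assms sandwich_def mmult_assoc)
qed

lemma sandwich_isometry_trace:
  assumes "mmult (adjoint J) J = idm" shows "mtrace (sandwich J A) = mtrace A"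
proof -
  have "mtrace (sandwich J A) = mtrace (mmult (mmult (adjoint J) J) A)"
    using mtrace_cyclic[of "mmult J A" "adjoint J"] by (simp add: sandwich_def mmult_assoc)
  then show ?thesis by (simp add: assms)
qed

lemma sandwich_isometry_sqrtm:
  assumes "mmult (adjoint J) J = idm" "psd A" shows "sqrtm (sandwich J A) = sandwich J (sqrtm A)"
  using assms by (intro sqrtm_eqI) (simp_all add: psd_sandwich psd_sqrtm sandwich_isometry_mmult mmult_sqrtm)

lemma adjoint_sandwich: "adjoint (sandwich K A) = sandwich K (adjoint A)"
  by (simp add: sandwich_def adjoint_mmult mmult_assoc)

lemma fid_isometry:
  assumes J: "mmult (adjoint J) J = idm" and "psd \<rho>" "psd \<sigma>"
  shows "fid (sandwich J \<rho>) (sandwich J \<sigma>) = fid \<rho> \<sigma>"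
proof -
  have "psd (mmult (adjoint M) M)" for M :: "'a qop"
    using psd_mmult_adjoint[of "adjoint M"] by simp
  then show ?thesis
    by (simp add: fid_def trace_norm_def assms sandwich_isometry_sqrtm sandwich_isometry_mmult
        adjoint_sandwich sandwich_isometry_trace)
qed

text \<open>The two summand embeddings of a direct sum. They pad a rectangular factor to a square
  one, to which the square case of Uhlmann's theorem applies.\<close>

definition inl :: "('a + 'b, 'a) cmat" where "inl = (\<lambda>x i. if x = Inl i then 1 else 0)"
definition inr :: "('a + 'b, 'b) cmat" where "inr = (\<lambda>x i. if x = Inr i then 1 else 0)"

lemma inl_isometry: "mmult (adjoint inl) (inl :: ('a::finite + 'b::finite, 'a) cmat) = idm"
  by (auto simp: mmult_def adjoint_def inl_def idm_def fun_eq_iff sum_UNIV_sum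
      if_distrib[of cnj] if_distrib[of "\<lambda>x. x * _"] cong: if_cong)

lemma inr_isometry: "mmult (adjoint inr) (inr :: ('a::finite + 'b::finite, 'b) cmat) = idm"
  by (auto simp: mmult_def adjoint_def inr_def idm_def fun_eq_iff sum_UNIV_sum
      if_distrib[of cnj] if_distrib[of "\<lambda>x. x * _"] cong: if_cong)

lemma inl_inr_complete:
  "(\<lambda>x y. mmult inl (adjoint inl) x y + mmult inr (adjoint inr) x y) = (idm :: ('a::finite + 'b::finite) qop)"
proof (intro ext)
  fix x y :: "'a + 'b"
  show "mmult inl (adjoint inl) x y + mmult inr (adjoint inr) x y = idm x y"
    by (cases x; cases y)
      (auto simp: mmult_def adjoint_def inl_def inr_def idm_def
       if_distrib[of cnj] if_distrib[of "\<lambda>x. x * _"] cong: if_cong)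
qed

text \<open>Each factor becomes an off-diagonal block of a square operator. In the products the
  embedding of the columns cancels, and the embedding of the rows is an isometry that changes
  neither traces nor fidelities.\<close>

lemma fid_ge:
  fixes A B :: "('a::finite, 'b::finite) cmat"
  shows "Re (mtrace (mmult A (adjoint B))) \<le> fid (mmult A (adjoint A)) (mmult B (adjoint B))"
proof -
  define J where "J = (inl :: ('a + 'b, 'a) cmat)"
  define L where "L = (inr :: ('a + 'b, 'b) cmat)"
  have J: "mmult (adjoint J) J = idm" by (simp add: J_def inl_isometry)
  define E where "E X = mmult (mmult J X) (adjoint L)" for X
  have E: "mmult (E X) (adjoint (E Y)) = sandwich J (mmult X (adjoint Y))" for X Y
  proof -
    have "mmult (E X) (adjoint (E Y))
        = mmult J (mmult X (mmult (mmult (adjoint L) L) (mmult (adjoint Y) (adjoint J))))"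
      by (simp add: E_def adjoint_mmult mmult_assoc)
    then show ?thesis by (simp add: L_def inr_isometry sandwich_def mmult_assoc)
  qed
  from fid_ge_square[of "E A" "E B"] show ?thesis
    unfolding E sandwich_isometry_trace[OF J] fid_isometry[OF J psd_mmult_adjoint psd_mmult_adjoint] .
qed

text \<open>Uhlmann's theorem. The purifying register of \<open>A\<close> may be too small to purify \<open>\<sigma>\<close>; enlarging it
  and discarding the part of the purification outside \<open>'b\<close> only costs equality of the marginal.\<close>
lemma fid_attained:
  fixes A :: "('a::finite, 'b::finite) cmat"
  assumes s: "psd \<sigma>"
  obtains B :: "('a, 'b) cmat" where "loewner_le (mmult B (adjoint B)) \<sigma>"
    "fid \<sigma> (mmult A (adjoint A)) = Re (mtrace (mmult A (adjoint B)))"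
proof -
  define J where "J = (inl :: ('a + 'b, 'a) cmat)"
  define L where "L = (inr :: ('a + 'b, 'b) cmat)"
  have J: "mmult (adjoint J) J = idm" by (simp add: J_def inl_isometry)
  define E where "E = mmult (mmult J A) (adjoint L)"
  have E: "mmult E (adjoint E) = sandwich J (mmult A (adjoint A))"
  proof -
    have "mmult E (adjoint E)
        = mmult J (mmult A (mmult (mmult (adjoint L) L) (mmult (adjoint A) (adjoint J))))"
      by (simp add: E_def adjoint_mmult mmult_assoc)
    then show ?thesis by (simp add: L_def inr_isometry sandwich_def mmult_assoc)
  qed
  obtain C where C: "mmult C (adjoint C) = sandwich J \<sigma>"
    and f: "fid (sandwich J \<sigma>) (mmult E (adjoint E)) = Re (mtrace (mmult E (adjoint C)))"
    by (rule fid_attained_square[OF psd_sandwich[OF s]])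
  define B where "B = mmult (adjoint J) (mmult C L)"
  have "mmult J (mmult A (mmult (adjoint L) (adjoint C))) = mmult E (adjoint C)"
    by (simp add: E_def mmult_assoc)
  then have "mtrace (mmult E (adjoint C)) = mtrace (mmult A (adjoint B))"
    using mtrace_cyclic[of J "mmult A (mmult (adjoint L) (adjoint C))"]
    by (simp add: B_def adjoint_mmult mmult_assoc)
  with f have fid: "fid \<sigma> (mmult A (adjoint A)) = Re (mtrace (mmult A (adjoint B)))"
    by (simp add: E fid_isometry[OF J s psd_mmult_adjoint])
  \<comment> \<open>\<open>G\<close> and \<open>B\<close> are the two blocks in the upper row of
    \<open>C\<close>. Their squares add up to the upper diagonal block of \<open>C\<close> times its
    adjoint, which is \<open>\<sigma>\<close>; so what \<open>B\<close> misses is positive.\<close>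
  define G where "G = mmult (adjoint J) (mmult C J)"
  have "(\<lambda>i j. mmult G (adjoint G) i j + mmult B (adjoint B) i j)
      = mmult (adjoint J) (mmult (mmult C (\<lambda>x y. mmult J (adjoint J) x y + mmult L (adjoint L) x y))
          (mmult (adjoint C) J))"
    by (simp add: G_def B_def adjoint_mmult mmult_assoc mmult_add_left mmult_add_right)
  also have "\<dots> = mmult (adjoint J) (mmult (mmult C (adjoint C)) J)"
    unfolding J_def L_def inl_inr_complete by (simp add: mmult_assoc)
  also have "\<dots> = mmult (mmult (adjoint J) J) (mmult \<sigma> (mmult (adjoint J) J))"
    unfolding C by (simp add: sandwich_def mmult_assoc)
  finally have "(\<lambda>i j. mmult G (adjoint G) i j + mmult B (adjoint B) i j) = \<sigma>" by (simp add: J)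
  then have "(\<lambda>i j. \<sigma> i j - mmult B (adjoint B) i j) = mmult G (adjoint G)"
    by (subst (asm) eq_commute) simp
  then have "loewner_le (mmult B (adjoint B)) \<sigma>"
    by (simp add: loewner_le_def psd_mmult_adjoint)
  with fid that show ?thesis by blast
qed

lemma fid_nonneg: "0 \<le> fid \<rho> \<sigma>"
proof -
  let ?M = "mmult (sqrtm \<rho>) (sqrtm \<sigma>)"
  have "psd (mmult (adjoint ?M) ?M)" using psd_mmult_adjoint[of "adjoint ?M"] by simp
  then have "psd (sqrtm (mmult (adjoint ?M) ?M))" by (rule psd_sqrtm)
  then show ?thesis unfolding fid_def trace_norm_def mtrace_def by (simp add: psd_diag sum_nonneg)
qed

text \<open>The rows of one factor of \<open>M\<close> split into factors of both diagonal blocks,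
  and the off-diagonal block is their mixed product. This form of the fidelity bound survives maps
  that act blockwise.\<close>

lemma fid_ge_block:
  fixes M :: "(bool \<times> 'a::finite) qop"
  assumes "psd M"
  shows "Re (\<Sum>i\<in>UNIV. M (True, i) (False, i))
    \<le> fid (\<lambda>i j. M (True, i) (True, j)) (\<lambda>i j. M (False, i) (False, j))"
proof -
  obtain G :: "(bool \<times> 'a) qop" where G: "M = mmult G (adjoint G)" using psd_factor[OF assms] by blast
  have "M (b, i) (b', j) = mmult (\<lambda>i k. G (b, i) k) (adjoint (\<lambda>i k. G (b', i) k)) i j" for b b' i j
    by (simp add: G mmult_def adjoint_def)
  then show ?thesis
    using fid_ge[of "\<lambda>i k. G (True, i) k" "\<lambda>i k. G (False, i) k"] by (simp add: mtrace_def)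
qed

section \<open>The triangle inequality\<close>

text \<open>The addition formula for the cosine: split off the components along \<open>b\<close> and
  apply Cauchy-Schwarz to the remainders.\<close>

lemma real_inner_triangle:
  fixes a b c :: "'v::real_inner"
  assumes "norm a \<le> 1" "norm b = 1" "norm c \<le> 1"
  shows "a \<bullet> b * (c \<bullet> b) - sqrt (1 - (a \<bullet> b)\<^sup>2) * sqrt (1 - (c \<bullet> b)\<^sup>2) \<le> a \<bullet> c"
proof -
  have b: "b \<bullet> b = 1" using assms(2) by (simp add: dot_square_norm)
  define p where "p x = x - (x \<bullet> b) *\<^sub>R b" for x
  have pp: "p x \<bullet> p y = x \<bullet> y - x \<bullet> b * (y \<bullet> b)" for x y
    by (simp add: p_def inner_diff_left inner_diff_right b inner_commute)
  have n: "norm (p x) \<le> sqrt (1 - (x \<bullet> b)\<^sup>2)" if "norm x \<le> 1" for x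
  proof -
    have "x \<bullet> x \<le> 1" using that by (simp add: dot_square_norm abs_square_le_1)
    then have "p x \<bullet> p x \<le> 1 - (x \<bullet> b)\<^sup>2" by (simp add: pp power2_eq_square)
    then show ?thesis by (simp add: norm_eq_sqrt_inner)
  qed
  have "\<bar>p a \<bullet> p c\<bar> \<le> norm (p a) * norm (p c)" by (rule Cauchy_Schwarz_ineq2)
  also have "\<dots> \<le> sqrt (1 - (a \<bullet> b)\<^sup>2) * sqrt (1 - (c \<bullet> b)\<^sup>2)"
    using order_trans[OF norm_ge_zero n[OF assms(1)]] by (intro mult_mono n assms norm_ge_zero)
  finally show ?thesis by (simp add: pp)
qed

lemma mtrace_eq_inner:
  fixes A B :: "('a::finite, 'b::finite) cmat"
  shows "Re (mtrace (mmult A (adjoint B))) = (\<chi> i j. A i j) \<bullet> (\<chi> i j. B i j)"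
  by (simp add: mtrace_mmult_adjoint inner_vec_def inner_complex_def)

lemma mtrace_eq_norm:
  fixes A :: "('a::finite, 'b::finite) cmat"
  shows "Re (mtrace (mmult A (adjoint A))) = (norm (\<chi> i j. A i j))\<^sup>2"
  by (simp add: mtrace_eq_inner dot_square_norm)

text \<open>Fix a factor of the middle operator \<open>b\<close> and choose factors of
  \<open>a\<close> and \<open>c\<close> with optimal overlap. The fidelities with \<open>b\<close>
  become inner products in Hilbert-Schmidt space, while the overlap of the other two factors only
  bounds \<open>fid a c\<close> from below, which is the direction required.\<close>

lemma fid_triangle:
  assumes "psd a" "psd b" "psd c" "Re (mtrace a) \<le> 1" "Re (mtrace b) = 1" "Re (mtrace c) \<le> 1"
  shows "fid a b * fid c b - sqrt (1 - (fid a b)\<^sup>2) * sqrt (1 - (fid c b)\<^sup>2) \<le> fid a c"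
    and "fid a b \<le> 1"
proof -
  obtain B :: "'a qop" where B: "b = mmult B (adjoint B)" using psd_factor[OF \<open>psd b\<close>] by blast
  obtain A where A: "mmult A (adjoint A) = a" "fid a b = Re (mtrace (mmult B (adjoint A)))"
    unfolding B by (rule fid_attained_square[OF \<open>psd a\<close>])
  obtain C where C: "mmult C (adjoint C) = c" "fid c b = Re (mtrace (mmult B (adjoint C)))"
    unfolding B by (rule fid_attained_square[OF \<open>psd c\<close>])
  let ?v = "\<lambda>X :: 'a qop. \<chi> i j. X i j"
  have n: "norm (?v A) \<le> 1" "norm (?v C) \<le> 1" "(norm (?v B))\<^sup>2 = 1\<^sup>2"
    using assms(4-6) unfolding A(1)[symmetric] B C(1)[symmetric] mtrace_eq_norm
    by (simp_all add: abs_square_le_1)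
  from n(3) have n': "norm (?v B) = 1" by (rule power2_eq_imp_eq) auto
  have "Re (mtrace (mmult A (adjoint C))) \<le> fid a c"
    using fid_ge[of A C] by (simp add: A C)
  then show "fid a b * fid c b - sqrt (1 - (fid a b)\<^sup>2) * sqrt (1 - (fid c b)\<^sup>2) \<le> fid a c"
    using real_inner_triangle[OF n(1) n' n(2)] by (simp add: A(2) C(2) mtrace_eq_inner inner_commute)
  have "?v A \<bullet> ?v B \<le> norm (?v A) * norm (?v B)" by (rule norm_cauchy_schwarz)
  then show "fid a b \<le> 1" using n n' by (simp add: A(2) mtrace_eq_inner inner_commute)
qed

text \<open>Turns the bound on cosines into one on purified distances. With \<open>f\<close> and
  \<open>g\<close> as cosines of two angles, the sine of the sum is at most the sum of the
  sines.\<close>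

lemma sine_addition_bound:
  fixes f g h \<epsilon> \<delta> :: real
  assumes f: "0 \<le> f" "f \<le> 1" "1 - f\<^sup>2 \<le> \<epsilon>\<^sup>2" and g: "0 \<le> g" "g \<le> 1" "1 - g\<^sup>2 \<le> \<delta>\<^sup>2"
    and e: "0 \<le> \<epsilon>" "0 \<le> \<delta>" "\<epsilon> + \<delta> < 1"
    and h: "f * g - sqrt (1 - f\<^sup>2) * sqrt (1 - g\<^sup>2) \<le> h"
  shows "1 - h\<^sup>2 \<le> (\<epsilon> + \<delta>)\<^sup>2"
proof -
  define s where "s = sqrt (1 - f\<^sup>2)"
  define t where "t = sqrt (1 - g\<^sup>2)"
  have ss: "s\<^sup>2 = 1 - f\<^sup>2" using f by (simp add: s_def abs_square_le_1)
  have tt: "t\<^sup>2 = 1 - g\<^sup>2" using g by (simp add: t_def abs_square_le_1)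
  have s: "0 \<le> s" "s \<le> \<epsilon>" using f e by (auto simp: s_def abs_square_le_1 intro: real_le_lsqrt)
  have t: "0 \<le> t" "t \<le> \<delta>" using g e by (auto simp: t_def abs_square_le_1 intro: real_le_lsqrt)
  \<comment> \<open>Here \<open>\<epsilon> + \<delta> < 1\<close> enters: it keeps the sum of the
    angles below a right angle, so the cosine \<open>f * g - s * t\<close> is nonnegative and the
    bound on \<open>h\<close> may be squared.\<close>
  have "s\<^sup>2 + t\<^sup>2 \<le> (s + t)\<^sup>2" using s t by (simp add: power2_sum)
  also have "\<dots> \<le> 1\<^sup>2" using s t e by (intro power_mono) auto
  finally have "s\<^sup>2 + t\<^sup>2 \<le> 1" by simp
  moreover have "(f * g)\<^sup>2 = 1 - s\<^sup>2 - t\<^sup>2 + (s * t)\<^sup>2"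
    unfolding power_mult_distrib ss tt by (simp add: algebra_simps)
  ultimately have "(s * t)\<^sup>2 \<le> (f * g)\<^sup>2" by simp
  then have "s * t \<le> f * g" using f g by (intro power2_le_imp_le[of "s * t"]) auto
  then have "(f * g - s * t)\<^sup>2 \<le> h\<^sup>2" using h by (intro power_mono) (auto simp: s_def t_def)
  moreover have "(f * g - s * t)\<^sup>2 + (s * g + t * f)\<^sup>2 = (f\<^sup>2 + s\<^sup>2) * (g\<^sup>2 + t\<^sup>2)"
    by (simp add: power2_eq_square algebra_simps)
  ultimately have "1 - h\<^sup>2 \<le> (s * g + t * f)\<^sup>2" by (simp add: ss tt)
  also have "\<dots> \<le> (\<epsilon> + \<delta>)\<^sup>2"
  proof (intro power_mono add_mono)
    show "s * g \<le> \<epsilon>" using mult_mono[of s \<epsilon> g 1] s g e by simp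
    show "t * f \<le> \<delta>" using mult_mono[of t \<delta> f 1] t f e by simp
  qed (use s t f g in auto)
  finally show ?thesis .
qed

lemma purified_dist_le_iff:
  assumes "mtrace \<sigma> = 1" "0 \<le> \<epsilon>"
  shows "purified_dist \<rho> \<sigma> \<le> \<epsilon> \<longleftrightarrow> 1 - (fid \<rho> \<sigma>)\<^sup>2 \<le> \<epsilon>\<^sup>2"
proof -
  have "purified_dist \<rho> \<sigma> = sqrt (1 - (fid \<rho> \<sigma>)\<^sup>2)"
    by (simp add: purified_dist_def gen_fidelity_def fid_def assms(1))
  \<comment> \<open>The real \<open>sqrt\<close> is strictly increasing on the whole line, with
    negative values at negative arguments, so the equivalence holds for every real
    \<open>x\<close>.\<close>
  moreover have "sqrt x \<le> \<epsilon> \<longleftrightarrow> x \<le> \<epsilon>\<^sup>2" for x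
    using real_sqrt_le_iff[of x "\<epsilon>\<^sup>2"] assms(2) by simp
  ultimately show ?thesis by simp
qed

subsection \<open>Completely positive maps\<close>

text \<open>Finite sums of Kraus terms, generated inductively so that linearity, composition and
  amplification follow by induction. The empty sum is conjugation by the zero matrix.\<close>

inductive cp :: "(('a::finite) qop \<Rightarrow> ('b::finite) qop) \<Rightarrow> bool" where
  cp_sandwich: "cp (sandwich K)"
| cp_plus: "cp \<Phi> \<Longrightarrow> cp \<Psi> \<Longrightarrow> cp (\<lambda>M i j. \<Phi> M i j + \<Psi> M i j)"

definition trace_preserving :: "(('a::finite) qop \<Rightarrow> ('b::finite) qop) \<Rightarrow> bool" where
  "trace_preserving \<Phi> \<longleftrightarrow> (\<forall>M. mtrace (\<Phi> M) = mtrace M)"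

lemma cp_psd: "cp \<Phi> \<Longrightarrow> psd M \<Longrightarrow> psd (\<Phi> M)"
  by (induction rule: cp.induct) (simp_all add: psd_sandwich psd_add)

lemma sandwich_add_right:
  "sandwich K (\<lambda>i j. A i j + B i j) = (\<lambda>i j. sandwich K A i j + sandwich K B i j)"
  by (simp add: sandwich_def mmult_add_left mmult_add_right)

lemma sandwich_scale_right: "sandwich K (\<lambda>i j. c * A i j) = (\<lambda>i j. c * sandwich K A i j)"
  by (simp add: sandwich_def mmult_scale_left mmult_scale_right)

lemma sandwich_mmult: "sandwich K (sandwich L M) = sandwich (mmult K L) M"
  by (simp add: sandwich_def adjoint_mmult mmult_assoc)

lemma sandwich_entry:
  "sandwich K M i j = (\<Sum>b\<in>UNIV. cnj (K j b) * (\<Sum>a\<in>UNIV. K i a * M a b))"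
  by (simp add: sandwich_def mmult_def adjoint_def mult.commute)

lemma tensor_idm_entry: "tensor idm K (r, i) (r', a) = (if r = r' then K i a else 0)"
  by (simp add: tensor_def idm_def)

lemma sum_tensor_idm:
  fixes f :: "('r::finite \<times> 'a::finite) \<Rightarrow> complex"
  shows "(\<Sum>x\<in>UNIV. tensor idm K (r, i) x * f x) = (\<Sum>a\<in>UNIV. K i a * f (r, a))"
    and "(\<Sum>x\<in>UNIV. cnj (tensor idm K (r, i) x) * f x) = (\<Sum>a\<in>UNIV. cnj (K i a) * f (r, a))"
proof -
  have *: "(\<Sum>a\<in>UNIV. tensor idm L (r, i) (r', a) * f (r', a))
      = (if r = r' then \<Sum>a\<in>UNIV. L i a * f (r, a) else 0)" for L :: "('b, 'a) cmat" and r'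
    by (simp add: tensor_idm_entry)
  show "(\<Sum>x\<in>UNIV. tensor idm K (r, i) x * f x) = (\<Sum>a\<in>UNIV. K i a * f (r, a))"
    unfolding sum_UNIV_prod * by simp
  have "cnj (tensor idm K (r, i) x) = tensor idm (\<lambda>i a. cnj (K i a)) (r, i) x" for x :: "'r \<times> 'a"
    by (cases x) (simp add: tensor_idm_entry)
  then show "(\<Sum>x\<in>UNIV. cnj (tensor idm K (r, i) x) * f x) = (\<Sum>a\<in>UNIV. cnj (K i a) * f (r, a))"
    unfolding sum_UNIV_prod by (simp add: *)
qed

lemma cp_add_apply:
  "cp \<Phi> \<Longrightarrow> \<Phi> (\<lambda>i j. A i j + B i j) = (\<lambda>i j. \<Phi> A i j + \<Phi> B i j)"
  by (induction rule: cp.induct) (simp_all add: sandwich_add_right algebra_simps)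

lemma cp_scale_apply: "cp \<Phi> \<Longrightarrow> \<Phi> (\<lambda>i j. c * A i j) = (\<lambda>i j. c * \<Phi> A i j)"
  by (induction rule: cp.induct) (simp_all add: sandwich_scale_right algebra_simps)

lemma cp_zero_apply: "cp \<Phi> \<Longrightarrow> \<Phi> (\<lambda>i j. 0) = (\<lambda>i j. 0)"
  using cp_scale_apply[of \<Phi> 0 "\<lambda>i j. 0"] by simp

lemma cp_diff_apply:
  "cp \<Phi> \<Longrightarrow> \<Phi> (\<lambda>i j. A i j - B i j) = (\<lambda>i j. \<Phi> A i j - \<Phi> B i j)"
  using cp_add_apply[of \<Phi> A "\<lambda>i j. (-1) * B i j"] cp_scale_apply[of \<Phi> "-1" B] by simp

lemma cp_sum_apply:
  assumes "cp \<Phi>" shows "\<Phi> (\<lambda>i j. \<Sum>k\<in>I. A k i j) = (\<lambda>i j. \<Sum>k\<in>I. \<Phi> (A k) i j)"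
  by (induction I rule: infinite_finite_induct)
    (simp_all add: cp_zero_apply[OF assms] cp_add_apply[OF assms])

lemma cp_zero: "cp ((\<lambda>M i j. 0) :: ('a::finite) qop \<Rightarrow> ('b::finite) qop)"
proof -
  have "sandwich (\<lambda>i j. 0) = ((\<lambda>M i j. 0) :: 'a qop \<Rightarrow> 'b qop)" by (simp add: sandwich_def mmult_def adjoint_def fun_eq_iff)
  then show ?thesis using cp_sandwich by metis
qed

lemma cp_sum:
  assumes "\<And>k. k \<in> I \<Longrightarrow> cp (\<Phi> k)" shows "cp (\<lambda>M i j. \<Sum>k\<in>I. \<Phi> k M i j)"
  using assms by (induction I rule: infinite_finite_induct) (simp_all add: cp_zero cp_plus)

lemma cp_comp:
  assumes "cp \<Phi>" "cp \<Psi>" shows "cp (\<lambda>M. \<Psi> (\<Phi> M))"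
  using assms(2)
proof (induction rule: cp.induct)
  case (cp_sandwich K)
  show ?case using assms(1)
    by (induction rule: cp.induct)
      (simp_all add: sandwich_mmult sandwich_add_right cp.cp_sandwich cp_plus)
qed (rule cp_plus)

lemma cp_app2:
  fixes \<Phi> :: "('a::finite) qop \<Rightarrow> ('b::finite) qop"
  assumes "cp \<Phi>" shows "cp (app2 \<Phi> :: ('r::finite \<times> 'a) qop \<Rightarrow> ('r \<times> 'b) qop)"
  using assms
proof (induction rule: cp.induct)
  case (cp_sandwich K)
  have "app2 (sandwich K) = (sandwich (tensor idm K) :: ('r \<times> 'a) qop \<Rightarrow> ('r \<times> 'b) qop)"
  proof (intro ext)
    fix M :: "('r \<times> 'a) qop" and x y :: "'r \<times> 'b"
    obtain r b where x: "x = (r, b)" by (cases x)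
    obtain r' b' where y: "y = (r', b')" by (cases y)
    show "app2 (sandwich K) M x y = sandwich (tensor idm K) M x y"
      by (simp add: x y app2_def sandwich_entry sum_tensor_idm)
  qed
  then show ?case by (simp only: cp.cp_sandwich)
next
  case (cp_plus \<Phi> \<Psi>)
  have "(app2 (\<lambda>M i j. \<Phi> M i j + \<Psi> M i j) :: ('r \<times> 'a) qop \<Rightarrow> ('r \<times> 'b) qop)
    = (\<lambda>M i j. app2 \<Phi> M i j + app2 \<Psi> M i j)"
    by (auto simp: app2_def fun_eq_iff)
  then show ?case using cp.cp_plus[OF cp_plus.IH] by (simp only:)
qed

text \<open>One nonzero entry per row covers three cases at once: relabelling, compression to one
  basis vector of a factor, and tensoring with a rank-one operator.\<close>

lemma sandwich_select:
  "sandwich (\<lambda>i a. if a = f i then w i else 0) M i j = w i * M (f i) (f j) * cnj (w j)"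
proof -
  have "(\<Sum>a\<in>UNIV. (if a = f k then c else 0) * g a) = c * g (f k)" for c k and g :: "'b \<Rightarrow> complex"
    by (simp add: if_distrib[of "\<lambda>x. x * _"] cong: if_cong)
  then show ?thesis by (simp add: sandwich_entry if_distrib[of cnj] cong: if_cong)
qed

lemma cp_reindex: "cp (reindex f)"
proof -
  have "reindex f = sandwich (\<lambda>i a. if a = f i then 1 else 0)"
    by (simp add: fun_eq_iff reindex_def sandwich_select)
  then show ?thesis by (simp only: cp_sandwich)
qed

lemma cp_ptrace2: "cp (ptrace2 :: ('a::finite \<times> 'b::finite) qop \<Rightarrow> 'a qop)"
proof -
  have *: "(ptrace2 :: ('a \<times> 'b) qop \<Rightarrow> 'a qop) = (\<lambda>M i j. \<Sum>b\<in>UNIV. reindex (\<lambda>a. (a, b)) M i j)"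
    by (simp add: ptrace2_def reindex_def fun_eq_iff)
  show ?thesis by (subst *) (intro cp_sum cp_reindex)
qed

lemma cp_tensor:
  fixes T :: "('b::finite) qop"
  assumes "psd T" shows "cp (\<lambda>M :: ('a::finite) qop. tensor M T)"
proof -
  obtain w :: "'b \<Rightarrow> 'b \<Rightarrow> complex" where w: "T = (\<lambda>i j. \<Sum>k\<in>UNIV. w k i * cnj (w k j))"
    using psd_rank_one_sum[OF assms] by blast
  define K :: "'b \<Rightarrow> ('a \<times> 'b, 'a) cmat" where "K = (\<lambda>k x a'. if a' = fst x then w k (snd x) else 0)"
  have "sandwich (K k) M (a, b) (a', b') = M a a' * (w k b * cnj (w k b'))" for k M a b a' b'
    by (simp add: K_def sandwich_select)
  then have "(\<lambda>M :: 'a qop. tensor M T) = (\<lambda>M i j. \<Sum>k\<in>UNIV. sandwich (K k) M i j)"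
    by (auto simp: fun_eq_iff tensor_def w sum_distrib_left)
  then show ?thesis by (simp only: cp_sum cp_sandwich)
qed

lemma is_channel_cp:
  assumes "is_channel \<Phi>" shows "cp \<Phi>"
proof -
  obtain n :: nat and K where
    "\<forall>M. \<Phi> M = (\<lambda>i j. \<Sum>k<n. mmult (mmult (K k) M) (adjoint (K k)) i j)"
    using assms unfolding is_channel_def by blast
  then have "\<Phi> = (\<lambda>M i j. \<Sum>k\<in>{..<n}. sandwich (K k) M i j)"
    by (simp add: sandwich_def fun_eq_iff)
  then show ?thesis by (simp only: cp_sum cp_sandwich)
qed

lemma is_channel_trace_preserving:
  assumes "is_channel \<Phi>" shows "trace_preserving \<Phi>"
proof -
  obtain n :: nat and K where
    F: "\<And>M. \<Phi> M = (\<lambda>i j. \<Sum>k<n. mmult (mmult (K k) M) (adjoint (K k)) i j)" and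
    K: "(\<lambda>i j. \<Sum>k<n. mmult (adjoint (K k)) (K k) i j) = idm"
    using assms unfolding is_channel_def by blast
  have "mtrace (\<Phi> M) = mtrace M" for M
  proof -
    have "mtrace (\<Phi> M) = (\<Sum>k<n. mtrace (mmult (mmult (K k) M) (adjoint (K k))))"
      unfolding F mtrace_def by (rule sum.swap)
    also have "\<dots> = (\<Sum>k<n. mtrace (mmult (mmult (adjoint (K k)) (K k)) M))"
      by (rule sum.cong[OF refl]) (simp add: mmult_assoc mtrace_cyclic[of "mmult (K _) M" "adjoint (K _)", unfolded mmult_assoc])
    also have "\<dots> = mtrace (mmult (\<lambda>i j. \<Sum>k<n. mmult (adjoint (K k)) (K k) i j) M)"
    proof -
      have "mmult (\<lambda>i j. \<Sum>k<n. X k i j) M i i = (\<Sum>k<n. mmult (X k) M i i)" for X i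
        unfolding mmult_def sum_distrib_right by (rule sum.swap)
      then show ?thesis unfolding mtrace_def by (simp add: sum.swap[of _ UNIV])
    qed
    finally show ?thesis by (simp add: K)
  qed
  then show ?thesis by (simp add: trace_preserving_def)
qed

lemma mtrace_app2: "trace_preserving \<Phi> \<Longrightarrow> mtrace (app2 \<Phi> M) = mtrace M"
  by (simp add: trace_preserving_def mtrace_def sum_UNIV_prod app2_def)

lemma mtrace_reindex: "bij f \<Longrightarrow> mtrace (reindex f M) = mtrace M"
  unfolding mtrace_def reindex_def by (rule sum.reindex_bij_betw)

lemma mtrace_ptrace2: "mtrace (ptrace2 M) = mtrace M"
  by (simp add: mtrace_def ptrace2_def sum_UNIV_prod)

lemma mtrace_tensor: "mtrace (tensor A B) = mtrace A * mtrace B"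
  by (simp add: mtrace_def tensor_def sum_UNIV_prod sum_product)

text \<open>Optimal factors of both states are stacked into one positive two-by-two block operator.
  Complete positivity keeps it positive under the blockwise map, and trace preservation keeps the
  trace of the off-diagonal block, whose real part is the old fidelity.\<close>

lemma fid_cp_mono:
  fixes \<rho> \<sigma> :: "('a::finite) qop"
  assumes \<Phi>: "cp \<Phi>" "trace_preserving \<Phi>" and psd: "psd \<rho>" "psd \<sigma>"
  shows "fid \<rho> \<sigma> \<le> fid (\<Phi> \<rho>) (\<Phi> \<sigma>)"
proof -
  obtain A :: "'a qop" where A: "\<sigma> = mmult A (adjoint A)" using psd_factor[OF psd(2)] by blast
  obtain B where B: "mmult B (adjoint B) = \<rho>" and f: "fid \<rho> \<sigma> = Re (mtrace (mmult A (adjoint B)))"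
    unfolding A by (rule fid_attained_square[OF psd(1)])
  define G :: "(bool \<times> 'a, 'a) cmat" where "G = (\<lambda>(b, i) k. if b then B i k else A i k)"
  have G: "mmult G (adjoint G) (b, i) (b', j)
      = mmult (if b then B else A) (adjoint (if b' then B else A)) i j" for b b' i j
    by (simp add: G_def mmult_def adjoint_def)
  have t: "mtrace (mmult B (adjoint A)) = cnj (mtrace (mmult A (adjoint B)))"
    by (simp add: adjoint_mmult flip: mtrace_adjoint)
  have "psd (app2 \<Phi> (mmult G (adjoint G)))" by (intro cp_psd[OF cp_app2] \<Phi> psd_mmult_adjoint)
  from fid_ge_block[OF this] have "Re (mtrace (\<Phi> (mmult B (adjoint A)))) \<le> fid (\<Phi> \<rho>) (\<Phi> \<sigma>)"
    by (simp add: app2_def G B A mtrace_def)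
  then show ?thesis using \<Phi>(2) t f by (simp add: trace_preserving_def)
qed

subsection \<open>Operator inequalities\<close>

lemma loewner_le_trans: "loewner_le A B \<Longrightarrow> loewner_le B C \<Longrightarrow> loewner_le A C"
  unfolding loewner_le_def by (drule (1) psd_add) simp

lemma loewner_le_cp: "cp \<Phi> \<Longrightarrow> loewner_le A B \<Longrightarrow> loewner_le (\<Phi> A) (\<Phi> B)"
  unfolding loewner_le_def using cp_psd[of \<Phi>] by (simp flip: cp_diff_apply)

lemma loewner_le_scale:
  assumes "0 \<le> c" "loewner_le A B"
  shows "loewner_le (\<lambda>i j. complex_of_real c * A i j) (\<lambda>i j. complex_of_real c * B i j)"
  using psd_scale[OF assms(2)[unfolded loewner_le_def] assms(1)]
  by (simp add: loewner_le_def right_diff_distrib)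

text \<open>Sum the nonnegative values of the form at \<open>e_i - e_j\<close> over all pairs
  \<open>i\<close>, \<open>j\<close>.\<close>

lemma psd_total_le_card_trace:
  fixes b :: "('q::finite) qop"
  assumes "psd b"
  shows "Re (\<Sum>i\<in>UNIV. \<Sum>j\<in>UNIV. b i j) \<le> real CARD('q) * Re (mtrace b)"
proof -
  have "0 \<le> Re (b i i - b j i - b i j + b j j)" for i j
    using assms qform_two[of b i "-1" j] unfolding psd_iff by (metis (no_types, lifting)
      add_uminus_conv_diff complex_cnj_minus complex_cnj_one mult_minus1 mult_1 minus_minus mult_minus_left)
  then have "0 \<le> (\<Sum>i\<in>UNIV. \<Sum>j\<in>UNIV. Re (b i i - b j i - b i j + b j j))"
    by (intro sum_nonneg)
  also have "\<dots> = 2 * (real CARD('q) * Re (mtrace b)) - 2 * Re (\<Sum>i\<in>UNIV. \<Sum>j\<in>UNIV. b i j)"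
    using sum.swap[of "\<lambda>i j. Re (b j i)" UNIV UNIV]
    by (simp add: sum.distrib sum_subtractf sum_negf mtrace_def sum_distrib_left)
  finally show ?thesis by simp
qed

lemma psd_tensor_idm:
  assumes "psd T" shows "psd (tensor idm T)"
  using cp_psd[OF cp_tensor[OF assms] psd_idm] .

text \<open>The only place where quantum and classical messages differ: a block matrix is dominated by
  (number of blocks) times its diagonal, and by its diagonal if it is block diagonal.\<close>
lemma register_bound:
  fixes \<Omega> :: "('q::finite \<times> 'r::finite) qop"
  assumes psd: "psd \<Omega>"
    and c: "c = real CARD('q) \<or> c = 1 \<and> (\<forall>q q' r r'. q \<noteq> q' \<longrightarrow> \<Omega> (q, r) (q', r') = 0)"
  shows "loewner_le \<Omega> (\<lambda>i j. complex_of_real c * tensor idm (\<lambda>r r'. \<Sum>q\<in>UNIV. \<Omega> (q, r) (q, r')) i j)"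
proof -
  let ?T = "\<lambda>r r'. \<Sum>q\<in>UNIV. \<Omega> (q, r) (q, r')"
  have blk: "psd (\<lambda>r r'. \<Omega> (q, r) (q, r'))" for q
    using cp_psd[OF cp_reindex[of "\<lambda>r. (q, r)"] psd] by (simp add: reindex_def)
  have T: "psd (tensor idm ?T :: ('q \<times> 'r) qop)"
    by (intro psd_tensor_idm psd_sum blk)
  have c0: "0 \<le> c" using c by auto
  show ?thesis unfolding loewner_le_def psd_iff
  proof (intro allI conjI)
    fix v :: "'q \<times> 'r \<Rightarrow> complex"
    let ?D = "\<lambda>i j. complex_of_real c * tensor idm ?T i j - \<Omega> i j"
    have e: "qform ?D v = complex_of_real c * qform (tensor idm ?T) v - qform \<Omega> v"
      by (simp add: qform_diff qform_scale)
    show "Im (qform ?D v) = 0" unfolding e using psd T by (simp add: psd_iff)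
    \<comment> \<open>Contracting each block of \<open>\<Omega>\<close> with the matching parts of
      \<open>v\<close> leaves a positive operator \<open>b\<close> on the message register alone.
      The sum of its entries is the form of \<open>\<Omega>\<close>; its trace sees only the
      diagonal blocks.\<close>
    define K :: "('q, 'q \<times> 'r) cmat" where "K = (\<lambda>q (q', r). if q' = q then cnj (v (q, r)) else 0)"
    define b where "b = sandwich K \<Omega>"
    have b: "psd b" unfolding b_def by (rule psd_sandwich[OF psd])
    have be: "b q q' = (\<Sum>r\<in>UNIV. \<Sum>r'\<in>UNIV. cnj (v (q, r)) * \<Omega> (q, r) (q', r') * v (q', r'))" for q q'
      unfolding b_def sandwich_entry K_def sum_distrib_left
      by (subst sum.swap) (simp add: sum_UNIV_prod if_distrib[of cnj]
        if_distrib[of "\<lambda>x. x * _"] if_distrib[of "\<lambda>x. _ * x"] sum.swap[of _ "UNIV :: 'r set" "UNIV :: 'q set"] mult_ac cong: if_cong)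
    have q: "qform \<Omega> v = (\<Sum>q\<in>UNIV. \<Sum>q'\<in>UNIV. b q q')"
      unfolding be qform_def sum_UNIV_prod
      by (simp add: sum.swap[of _ "UNIV :: 'r set" "UNIV :: 'q set"])
    have "qform (tensor idm ?T) v = (\<Sum>q\<in>UNIV. qform ?T (\<lambda>r. v (q, r)))"
      unfolding qform_def sum_UNIV_prod
      by (simp add: tensor_idm_entry if_distrib[of "\<lambda>x. x * _"] if_distrib[of "\<lambda>x. _ * x"]
          sum.swap[of _ "UNIV :: 'r set" "UNIV :: 'q set"] cong: if_cong)
    also have "\<dots> = (\<Sum>q\<in>UNIV. \<Sum>q'\<in>UNIV. qform (\<lambda>r r'. \<Omega> (q', r) (q', r')) (\<lambda>r. v (q, r)))"
      unfolding qform_def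
      by (simp add: sum_distrib_left sum_distrib_right sum.swap[of _ "UNIV :: 'r set" "UNIV :: 'q set"])
    finally have t: "Re (qform (tensor idm ?T) v)
        = (\<Sum>q\<in>UNIV. \<Sum>q'\<in>UNIV. Re (qform (\<lambda>r r'. \<Omega> (q', r) (q', r')) (\<lambda>r. v (q, r))))" by simp
    have "Re (mtrace b) = (\<Sum>q\<in>UNIV. Re (qform (\<lambda>r r'. \<Omega> (q, r) (q, r')) (\<lambda>r. v (q, r))))"
      by (simp add: mtrace_def be qform_def)
    \<comment> \<open>The dropped terms pair a diagonal block with the part of \<open>v\<close> at a
      different message index; they are nonnegative.\<close>
    also have "\<dots> \<le> Re (qform (tensor idm ?T) v)"
      unfolding t using blk unfolding psd_iff
      by (intro sum_mono member_le_sum) auto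
    finally have tr: "c * Re (mtrace b) \<le> c * Re (qform (tensor idm ?T) v)"
      using c0 by (rule mult_left_mono)
    have "Re (qform \<Omega> v) \<le> c * Re (mtrace b)"
      using c
    proof
      assume "c = real CARD('q)"
      then show ?thesis unfolding q using psd_total_le_card_trace[OF b] by simp
    next
      assume c: "c = 1 \<and> (\<forall>q q' r r'. q \<noteq> q' \<longrightarrow> \<Omega> (q, r) (q', r') = 0)"
      then have off: "b q q' = 0" if "q \<noteq> q'" for q q' unfolding be using that by simp
      have "(\<Sum>q'\<in>UNIV. b q q') = (\<Sum>q'\<in>{q}. b q q')" for q
        by (rule sum.mono_neutral_right) (auto intro: off)
      then show ?thesis unfolding q using c by (simp add: mtrace_def)
    qed
    then show "0 \<le> Re (qform ?D v)" unfolding e using tr by simp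
  qed
qed

text \<open>A classical output register is specified on normalised states, but the encoder is
  applied to blocks that need not be states. Scaling reaches every positive operator, and these span
  all operators.\<close>

lemma cp_entry_zero:
  fixes \<Phi> :: "('a::finite) qop \<Rightarrow> ('b::finite) qop"
  assumes cp: "cp \<Phi>" and 0: "\<And>M. density_eq M \<Longrightarrow> \<Phi> M a b = 0"
  shows "\<Phi> M a b = 0"
proof -
  have p: "\<Phi> (mmult X (adjoint X)) a b = 0" for X :: "'a qop"
  proof (cases "X = (\<lambda>i j. 0)")
    case True
    then show ?thesis using cp_zero_apply[OF cp] by (simp add: mmult_def)
  next
    case False
    define t where "t = Re (mtrace (mmult X (adjoint X)))"
    have t: "mtrace (mmult X (adjoint X)) = complex_of_real t"
      by (simp add: t_def mtrace_mmult_adjoint_self)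
    have "0 \<le> t" by (simp add: t_def mtrace_mmult_adjoint_self sum_nonneg)
    moreover have "t \<noteq> 0" using mtrace_mmult_adjoint_self_0[of X] False by (auto simp: t_def)
    ultimately have t0: "0 < t" by simp
    define N where "N = (\<lambda>i j. complex_of_real (1 / t) * mmult X (adjoint X) i j)"
    have "mtrace N = complex_of_real (1 / t) * mtrace (mmult X (adjoint X))"
      by (simp add: N_def mtrace_def sum_distrib_left)
    then have "mtrace N = 1" using t0 by (simp add: t)
    moreover have "psd N" unfolding N_def using t0 by (intro psd_scale psd_mmult_adjoint) simp
    ultimately have "\<Phi> N a b = 0" by (intro 0) (simp add: density_eq_def)
    then show ?thesis unfolding N_def cp_scale_apply[OF cp] using t0 by simp
  qed
  define S where "S c = mmult (\<lambda>i j. M i j + c * idm i j) (adjoint (\<lambda>i j. M i j + c * idm i j))" for c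
  have S: "S c i j = mmult M (adjoint M) i j + cnj c * M i j + c * adjoint M i j + c * cnj c * idm i j" for c i j
  proof -
    have "adjoint (\<lambda>i j. M i j + c * idm i j) = (\<lambda>i j. adjoint M i j + cnj c * idm i j)"
      by (auto simp: adjoint_def idm_def fun_eq_iff)
    then show ?thesis
      by (simp add: S_def mmult_add_left mmult_add_right mmult_scale_left mmult_scale_right algebra_simps)
  qed
  \<comment> \<open>polarization of \<open>M = M \<cdot> 1\<^sup>\<dagger>\<close>\<close>
  have "M = (\<lambda>i j. (1/4) * ((S 1 i j + \<i> * S \<i> i j) + ((-1) * S (-1) i j + (-\<i>) * S (-\<i>) i j)))"
    by (intro ext) (simp add: S algebra_simps)
  then have "\<Phi> M = \<Phi> (\<lambda>i j. (1/4) * ((S 1 i j + \<i> * S \<i> i j) + ((-1) * S (-1) i j + (-\<i>) * S (-\<i>) i j)))"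
    by simp
  also have "\<dots> = (\<lambda>i j. (1/4) * ((\<Phi> (S 1) i j + \<i> * \<Phi> (S \<i>) i j) +
      ((-1) * \<Phi> (S (-1)) i j + (-\<i>) * \<Phi> (S (-\<i>)) i j)))"
    unfolding cp_add_apply[OF cp] cp_scale_apply[OF cp] ..
  finally show ?thesis using p by (simp add: S_def)
qed

subsection \<open>Redistribution protocols\<close>

definition discard :: "(('s \<times> 'p::finite) \<times> 'w) qop \<Rightarrow> ('s \<times> 'w) qop" where
  "discard M = ptrace2 (reindex (\<lambda>((s, w), p). ((s, p), w)) M)"

text \<open>Each relabelling moves the registers held by the acting party into the second factor,
  where \<open>app2\<close> acts; the first factor collects the spectators.\<close>

definition redistribute ::
  "(('l \<times> 'p \<times> 'x) qop \<Rightarrow> ('p \<times> 'q) qop) \<Rightarrow> (('q \<times> 'e \<times> 'y) qop \<Rightarrow> ('l \<times> 'e) qop) \<Rightarrow>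
   ('x \<times> 'y) qop \<Rightarrow> (('s \<times> 'l \<times> 'e) \<times> 'p) qop \<Rightarrow> (('s \<times> 'p) \<times> 'l \<times> 'e) qop" where
  "redistribute Enc Dec \<rho>XY M = app2 Dec (reindex (\<lambda>((s, p), (q, e, y)). ((s, e, y), (p, q)))
     (app2 Enc (reindex (\<lambda>((s, e, y), (l, p, x)). (((s, l, e), p), (x, y))) (tensor M \<rho>XY))))"

lemma cp_discard: "cp discard"
proof -
  have "cp (\<lambda>M. discard M)" unfolding discard_def by (intro cp_comp[OF cp_reindex cp_ptrace2])
  then show ?thesis by simp
qed

lemma bij_regroup:
  "bij (\<lambda>((s, w), p). ((s, p), w))"
  "bij (\<lambda>((s, p), (q, e, y)). ((s, e, y), (p, q)))"
  "bij (\<lambda>((s, e, y), (l, p, x)). (((s, l, e), p), (x, y)))"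
  "bij (\<lambda>(y, x). (x, y))"
  "bij (\<lambda>((s, e), (l, p)). ((s, l, e), p))"
proof -
  show "bij (\<lambda>((s, w), p). ((s, p), w))"
    by (rule o_bij[where g = "\<lambda>((s, p), w). ((s, w), p)"]) (auto simp: fun_eq_iff)
  show "bij (\<lambda>((s, p), (q, e, y)). ((s, e, y), (p, q)))"
    by (rule o_bij[where g = "\<lambda>((s, e, y), (p, q)). ((s, p), (q, e, y))"]) (auto simp: fun_eq_iff)
  show "bij (\<lambda>((s, e, y), (l, p, x)). (((s, l, e), p), (x, y)))"
    by (rule o_bij[where g = "\<lambda>(((s, l, e), p), (x, y)). ((s, e, y), (l, p, x))"]) (auto simp: fun_eq_iff)
  show "bij (\<lambda>(y, x). (x, y))"
    by (rule o_bij[where g = "\<lambda>(x, y). (y, x)"]) (auto simp: fun_eq_iff)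
  show "bij (\<lambda>((s, e), (l, p)). ((s, l, e), p))"
    by (rule o_bij[where g = "\<lambda>((s, l, e), p). ((s, e), (l, p))"]) (auto simp: fun_eq_iff)
qed

lemma trace_preserving_discard: "trace_preserving discard"
  by (simp add: trace_preserving_def discard_def mtrace_ptrace2 mtrace_reindex bij_regroup)

lemma discard_entry: "discard M (s, w) (s', w') = (\<Sum>p\<in>UNIV. M ((s, p), w) ((s', p), w'))"
  by (simp add: discard_def ptrace2_def reindex_def)

text \<open>The decoder does not touch \<open>P\<close>, so by linearity \<open>P\<close> may be
  discarded before decoding.\<close>

lemma discard_app2:
  assumes "cp \<Phi>" shows "discard (app2 \<Phi> M) = app2 \<Phi> (discard M)"
proof -
  have "discard (app2 \<Phi> M) (s, w) (s', w') = app2 \<Phi> (discard M) (s, w) (s', w')" for s w s' w'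
    by (simp add: discard_entry app2_def cp_sum_apply[OF assms])
  then show ?thesis by (simp add: fun_eq_iff)
qed

lemma cp_redistribute:
  assumes "cp Enc" "cp Dec" "psd \<rho>XY" shows "cp (redistribute Enc Dec \<rho>XY)"
proof -
  have "cp (\<lambda>M. redistribute Enc Dec \<rho>XY M)"
    unfolding redistribute_def
    by (intro cp_comp[OF _ cp_app2[OF assms(2)]] cp_comp[OF _ cp_reindex]
        cp_comp[OF _ cp_app2[OF assms(1)]] cp_tensor assms)
  then show ?thesis by simp
qed

lemma trace_preserving_redistribute:
  assumes "trace_preserving Enc" "trace_preserving Dec" "mtrace \<rho>XY = 1"
  shows "trace_preserving (redistribute Enc Dec \<rho>XY)"
  by (subst trace_preserving_def)
    (simp add: redistribute_def mtrace_app2 assms mtrace_reindex bij_regroup mtrace_tensor)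

lemma discard_redistribute_bound:
  fixes \<phi> :: "(('s::finite \<times> 'l::finite \<times> 'e::finite) \<times> 'p::finite) qop"
    and \<rho>XY :: "('x::finite \<times> 'y::finite) qop"
    and Enc :: "('l \<times> 'p \<times> 'x) qop \<Rightarrow> ('p \<times> 'q::finite) qop"
    and Dec :: "('q \<times> 'e \<times> 'y) qop \<Rightarrow> ('l \<times> 'e) qop"
  assumes phi: "psd \<phi>" and rho: "density_eq \<rho>XY" and Enc: "is_channel Enc" and Dec: "is_channel Dec"
    and c: "c = real CARD('q) \<or>
      c = 1 \<and> (\<forall>M. density_eq M \<longrightarrow> (\<forall>p q p' q'. q \<noteq> q' \<longrightarrow> Enc M (p, q) (p', q') = 0))"
    and \<sigma>: "density_le \<sigma>" and \<mu>: "0 \<le> \<mu>"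
    and le: "loewner_le (ptrace2 (reindex (\<lambda>((s, e), (l, p)). ((s, l, e), p)) \<phi>))
        (\<lambda>i j. complex_of_real \<mu> * tensor idm \<sigma> i j)"
  shows "\<exists>\<sigma>'. density_le \<sigma>' \<and> loewner_le (discard (redistribute Enc Dec \<rho>XY \<phi>))
    (\<lambda>i j. complex_of_real (c * real CARD('q) * \<mu>) * tensor idm \<sigma>' i j)"
proof -
  note cpE = is_channel_cp[OF Enc] and cpD = is_channel_cp[OF Dec]
  note tpE = is_channel_trace_preserving[OF Enc] and tpD = is_channel_trace_preserving[OF Dec]
  define \<rho>Y where "\<rho>Y = ptrace2 (reindex (\<lambda>(y, x). (x, y)) \<rho>XY)"
  have Y: "psd \<rho>Y"
    using rho unfolding \<rho>Y_def density_eq_def by (intro cp_psd[OF cp_ptrace2] cp_psd[OF cp_reindex]) simp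
  have trY: "mtrace \<rho>Y = 1"
    using rho by (simp add: \<rho>Y_def mtrace_ptrace2 mtrace_reindex bij_regroup density_eq_def)
  define \<phi>SE where "\<phi>SE = ptrace2 (reindex (\<lambda>((s, e), (l, p)). ((s, l, e), p)) \<phi>)"
  define W where "W = app2 Enc (reindex (\<lambda>((s, e, y), (l, p, x)). (((s, l, e), p), (x, y))) (tensor \<phi> \<rho>XY))"
  have W: "psd W"
    using phi rho unfolding W_def density_eq_def
    by (intro cp_psd[OF cp_app2] cpE cp_psd[OF cp_reindex] cp_psd[OF cp_tensor]) auto
  \<comment> \<open>The state between encoding and decoding, with \<open>P\<close> discarded: the
    message together with the registers \<open>S\<close>, \<open>E\<close>, \<open>Y\<close> that
    the encoder leaves alone.\<close>
  define \<Omega> :: "('q \<times> 's \<times> 'e \<times> 'y) qop" where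
    "\<Omega> = ptrace2 (reindex (\<lambda>((q, r), p). (r, (p, q))) W)"
  have \<Omega>: "psd \<Omega>" unfolding \<Omega>_def by (intro cp_psd[OF cp_ptrace2] cp_psd[OF cp_reindex] W)
  define G where "G = reindex (\<lambda>(s, e, y). ((s, e), y)) (tensor \<phi>SE \<rho>Y)"
  \<comment> \<open>Discarding both \<open>P\<close> and \<open>Q\<close> traces out the entire
    output of the encoder. Trace preservation then removes the encoder, and the product with the
    \<open>Y\<close> marginal remains.\<close>
  have G: "(\<lambda>r r'. \<Sum>q\<in>UNIV. \<Omega> (q, r) (q, r')) = G"
  proof (intro ext)
    fix r r' :: "'s \<times> 'e \<times> 'y"
    obtain s e y where r: "r = (s, e, y)" by (cases r)
    obtain s' e' y' where r': "r' = (s', e', y')" by (cases r')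
    have "(\<Sum>q\<in>UNIV. \<Omega> (q, r) (q, r')) = (\<Sum>q\<in>UNIV. \<Sum>p\<in>UNIV. W (r, (p, q)) (r', (p, q)))"
      by (simp add: \<Omega>_def ptrace2_def reindex_def)
    also have "\<dots> = mtrace (\<lambda>z z'. W (r, z) (r', z'))"
      unfolding mtrace_def sum_UNIV_prod by (rule sum.swap)
    also have "\<dots> = mtrace (\<lambda>z z'. reindex (\<lambda>((s, e, y), (l, p, x)). (((s, l, e), p), (x, y)))
        (tensor \<phi> \<rho>XY) (r, z) (r', z'))"
      using tpE by (simp add: W_def app2_def trace_preserving_def)
    also have "\<dots> = (\<Sum>l\<in>UNIV. \<Sum>p\<in>UNIV. \<Sum>x\<in>UNIV. \<phi> ((s, l, e), p) ((s', l, e'), p) * \<rho>XY (x, y) (x, y'))"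
      by (simp add: mtrace_def sum_UNIV_prod reindex_def tensor_def r r')
    also have "\<dots> = (\<Sum>l\<in>UNIV. \<Sum>p\<in>UNIV. \<phi> ((s, l, e), p) ((s', l, e'), p)) * (\<Sum>x\<in>UNIV. \<rho>XY (x, y) (x, y'))"
      by (simp only: sum_distrib_right) (simp only: sum_distrib_left)
    also have "\<dots> = G r r'"
      by (simp add: G_def \<phi>SE_def \<rho>Y_def ptrace2_def reindex_def tensor_def r r' sum_UNIV_prod)
    finally show "(\<Sum>q\<in>UNIV. \<Omega> (q, r) (q, r')) = G r r'" .
  qed
  have c0: "0 \<le> c" using c by auto
  have "c = real CARD('q) \<or> c = 1 \<and> (\<forall>q q' r r'. q \<noteq> q' \<longrightarrow> \<Omega> (q, r) (q', r') = 0)"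
  proof (cases "c = real CARD('q)")
    case False
    with c have 1: "c = 1" and
      d: "\<forall>M. density_eq M \<longrightarrow> (\<forall>p q p' q'. q \<noteq> q' \<longrightarrow> Enc M (p, q) (p', q') = 0)" by simp_all
    have "Enc M (p, q) (p', q') = 0" if "q \<noteq> q'" for M p q p' q'
      by (rule cp_entry_zero[OF cpE]) (rule d[rule_format, OF _ that])
    then have "\<Omega> (q, r) (q', r') = 0" if "q \<noteq> q'" for q q' r r'
      using that by (simp add: \<Omega>_def ptrace2_def reindex_def W_def app2_def)
    with 1 show ?thesis by simp
  qed simp
  from register_bound[OF \<Omega> this]
  have 1: "loewner_le \<Omega> (\<lambda>i j. complex_of_real c * tensor idm G i j)" unfolding G .
  define T0 :: "('s \<times> 'e \<times> 'y) qop" where "T0 = tensor idm (tensor \<sigma> \<rho>Y)"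
  have 2: "loewner_le G (\<lambda>i j. complex_of_real \<mu> * T0 i j)"
  proof -
    have "loewner_le G (reindex (\<lambda>(s, e, y). ((s, e), y)) (tensor (\<lambda>i j. complex_of_real \<mu> * tensor idm \<sigma> i j) \<rho>Y))"
      unfolding G_def using le unfolding \<phi>SE_def[symmetric]
      by (intro loewner_le_cp[OF cp_reindex] loewner_le_cp[OF cp_tensor[OF Y]])
    moreover have "reindex (\<lambda>(s, e, y). ((s, e), y)) (tensor (\<lambda>i j. complex_of_real \<mu> * tensor idm \<sigma> i j) \<rho>Y)
        = (\<lambda>i j. complex_of_real \<mu> * T0 i j)"
      by (auto simp: fun_eq_iff reindex_def tensor_def T0_def)
    ultimately show ?thesis by simp
  qed
  have 3: "loewner_le (tensor idm G :: ('q \<times> 's \<times> 'e \<times> 'y) qop)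
      (\<lambda>i j. complex_of_real \<mu> * tensor idm T0 i j)"
  proof -
    have "psd (tensor idm (\<lambda>i j. complex_of_real \<mu> * T0 i j - G i j) :: ('q \<times> 's \<times> 'e \<times> 'y) qop)"
      using 2 unfolding loewner_le_def by (rule psd_tensor_idm)
    moreover have "(tensor idm (\<lambda>i j. complex_of_real \<mu> * T0 i j - G i j) :: ('q \<times> 's \<times> 'e \<times> 'y) qop)
        = (\<lambda>i j. complex_of_real \<mu> * tensor idm T0 i j - tensor idm G i j)"
      by (auto simp: fun_eq_iff tensor_def algebra_simps)
    ultimately show ?thesis by (simp add: loewner_le_def)
  qed
  \<comment> \<open>\<open>T\<close> is \<open>T0\<close> without \<open>S\<close>, tensored with
    the identity on \<open>Q\<close>. Since \<open>S\<close> carries the identity throughout,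
    decoding acts on \<open>T\<close> and leaves that identity in front.\<close>
  define T :: "('q \<times> 'e \<times> 'y) qop" where "T = tensor idm (tensor \<sigma> \<rho>Y)"
  have "loewner_le \<Omega> (\<lambda>i j. complex_of_real (c * \<mu>) * tensor idm T0 i j)"
    using loewner_le_trans[OF 1 loewner_le_scale[OF c0 3]] by (simp add: mult.assoc)
  from loewner_le_cp[OF cp_comp[OF cp_reindex[of "\<lambda>(s, (q, e, y)). (q, (s, e, y))"] cp_app2[OF cpD]] this]
  have 4: "loewner_le (app2 Dec (reindex (\<lambda>(s, (q, e, y)). (q, (s, e, y))) \<Omega>))
     (app2 Dec (reindex (\<lambda>(s, (q, e, y)). (q, (s, e, y))) (\<lambda>i j. complex_of_real (c * \<mu>) * tensor idm T0 i j)))" .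
  have L: "discard (redistribute Enc Dec \<rho>XY \<phi>) = app2 Dec (reindex (\<lambda>(s, (q, e, y)). (q, (s, e, y))) \<Omega>)"
  proof -
    have "discard (reindex (\<lambda>((s, p), (q, e, y)). ((s, e, y), (p, q))) W)
        = reindex (\<lambda>(s, (q, e, y)). (q, (s, e, y))) \<Omega>"
      by (auto simp: fun_eq_iff discard_entry \<Omega>_def ptrace2_def reindex_def)
    then show ?thesis by (simp add: redistribute_def discard_app2[OF cpD] flip: W_def)
  qed
  have R: "app2 Dec (reindex (\<lambda>(s, (q, e, y)). (q, (s, e, y))) (\<lambda>i j. complex_of_real (c * \<mu>) * tensor idm T0 i j))
     = (\<lambda>i j. complex_of_real (c * \<mu>) * tensor idm (Dec T) i j)"
  proof -
    have "reindex (\<lambda>(s, (q, e, y)). (q, (s, e, y))) (\<lambda>i j. complex_of_real (c * \<mu>) * tensor idm T0 i j)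
        (s, w) (s', w') = (if s = s' then complex_of_real (c * \<mu>) else 0) * T w w'" for s s' :: 's and w w'
      by (cases w; cases w') (auto simp: reindex_def tensor_def T0_def T_def idm_def)
    then show ?thesis
      by (auto simp: fun_eq_iff app2_def cp_scale_apply[OF cpD] tensor_idm_entry)
  qed
  \<comment> \<open>The identity on \<open>Q\<close> multiplies the trace by \<open>|Q|\<close>.
    Dividing by it restores the trace of \<open>\<sigma>\<close> and moves one factor
    \<open>|Q|\<close> into the constant of the bound.\<close>
  define \<sigma>' where "\<sigma>' = (\<lambda>i j. complex_of_real (1 / real CARD('q)) * Dec T i j)"
  have T: "psd T" unfolding T_def using \<sigma> Y
    by (intro psd_tensor_idm cp_psd[OF cp_tensor]) (auto simp: density_le_def)
  have "mtrace (idm :: 'q qop) = of_nat CARD('q)" by (simp add: mtrace_def idm_def)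
  then have trT: "mtrace T = of_nat CARD('q) * mtrace \<sigma>"
    by (simp add: T_def mtrace_tensor trY)
  have "mtrace \<sigma>' = mtrace \<sigma>"
  proof -
    have "mtrace \<sigma>' = complex_of_real (1 / real CARD('q)) * mtrace (Dec T)"
      by (simp add: \<sigma>'_def mtrace_def sum_distrib_left)
    then show ?thesis using tpD by (simp add: trace_preserving_def trT)
  qed
  moreover have "psd \<sigma>'" unfolding \<sigma>'_def by (intro psd_scale cp_psd[OF cpD] T) simp
  ultimately have "density_le \<sigma>'" using \<sigma> by (simp add: density_le_def)
  moreover have E: "(\<lambda>i j. complex_of_real (c * \<mu>) * tensor idm (Dec T) i j)
      = (\<lambda>i j. complex_of_real (c * real CARD('q) * \<mu>) * tensor idm \<sigma>' i j)"
    by (auto simp: fun_eq_iff tensor_def \<sigma>'_def)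
  ultimately show ?thesis using 4 unfolding L R E by blast
qed

section \<open>Min-entropy and smoothing\<close>

text \<open>Every feasible pair \<open>(\<sigma>, \<mu>)\<close> for the first operator yields one
  with \<open>c * \<mu>\<close> for the second. Comparing the infima pair by pair avoids choosing
  minimisers.\<close>

lemma Hmin_up_mono:
  fixes \<rho>' :: "('a::finite \<times> 'b::finite) qop" and \<rho>'' :: "('a \<times> 'c::finite) qop"
  assumes c: "0 < c" and
    le: "\<And>\<sigma> \<mu>. density_le \<sigma> \<Longrightarrow> 0 \<le> \<mu> \<Longrightarrow> loewner_le \<rho>' (\<lambda>i j. complex_of_real \<mu> * tensor idm \<sigma> i j)
      \<Longrightarrow> \<exists>\<sigma>'. density_le \<sigma>' \<and> loewner_le \<rho>'' (\<lambda>i j. complex_of_real (c * \<mu>) * tensor idm \<sigma>' i j)"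
  shows "Hmin_up \<rho>' - ereal (log 2 c) \<le> Hmin_up \<rho>''"
proof -
  let ?t = "\<lambda>\<mu>::real. if \<mu> = 0 then -\<infinity> else ereal (log 2 \<mu>)"
  let ?I = "INF \<sigma>\<in>{\<sigma> :: 'c qop. density_le \<sigma>}. Dmax \<rho>'' (tensor idm \<sigma>)"
  have "?I - ereal (log 2 c) \<le> (INF \<sigma>\<in>{\<sigma> :: 'b qop. density_le \<sigma>}. Dmax \<rho>' (tensor idm \<sigma>))"
    unfolding Dmax_def[of \<rho>']
  proof (intro INF_greatest)
    fix \<sigma> :: "'b qop" and \<mu>
    assume "\<sigma> \<in> {\<sigma>. density_le \<sigma>}" and
      \<mu>: "\<mu> \<in> {\<mu>. 0 \<le> \<mu> \<and> loewner_le \<rho>' (\<lambda>i j. complex_of_real \<mu> * tensor idm \<sigma> i j)}"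
    then obtain \<sigma>' where \<sigma>': "density_le \<sigma>'"
      "loewner_le \<rho>'' (\<lambda>i j. complex_of_real (c * \<mu>) * tensor idm \<sigma>' i j)" using le by blast
    have "?I \<le> Dmax \<rho>'' (tensor idm \<sigma>')" using \<sigma>'(1) by (intro INF_lower) simp
    also have "\<dots> \<le> ?t (c * \<mu>)"
      unfolding Dmax_def using \<sigma>'(2) \<mu> c by (intro INF_lower) simp
    finally have "?I \<le> ?t (c * \<mu>)" .
    \<comment> \<open>Since \<open>c\<close> is positive, \<open>c * \<mu>\<close> is zero exactly
      when \<open>\<mu>\<close> is, so the value \<open>-\<infinity>\<close> for the logarithm of
      zero agrees on both sides.\<close>
    moreover have "?t (c * \<mu>) = ?t \<mu> + ereal (log 2 c)"
      using c \<mu> by (auto simp: log_mult)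
    ultimately show "?I - ereal (log 2 c) \<le> ?t \<mu>" by (simp add: ereal_minus_le)
  qed
  moreover have "- j - ereal r \<le> - i" if "i - ereal r \<le> j" for i j r
    using that by (cases i; cases j) auto
  ultimately show ?thesis unfolding Hmin_up_def by blast
qed

lemma ketbra_eq_mmult:
  "ketbra \<psi> = mmult (\<lambda>i (_::unit). \<psi> i) (adjoint (\<lambda>i (_::unit). \<psi> i))"
  by (simp add: ketbra_def mmult_def adjoint_def)

lemma psd_ketbra: "psd (ketbra \<psi>)"
  unfolding ketbra_eq_mmult by (rule psd_mmult_adjoint)

lemma loewner_le_mtrace:
  assumes "loewner_le A B" shows "Re (mtrace A) \<le> Re (mtrace B)"
proof -
  have "0 \<le> Re (mtrace (\<lambda>i j. B i j - A i j))"
    using assms psd_diag(2) unfolding loewner_le_def mtrace_def by (simp only: Re_sum) (intro sum_nonneg, blast)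
  then show ?thesis by (simp add: mtrace_diff)
qed

text \<open>Across the cut between \<open>SE\<close> and \<open>LP\<close> a vector is a matrix
  whose product with its adjoint is the \<open>SE\<close> marginal, so Uhlmann's theorem for
  rectangular factors supplies the vector \<open>\<phi>\<close>. The overlap of the vectors bounds
  the fidelity of the pure operators from below.\<close>

lemma smooth_extension:
  fixes \<psi> :: "('s::finite \<times> 'l::finite \<times> 'e::finite) \<times> 'p::finite \<Rightarrow> complex"
  assumes psd: "psd \<rho>'"
  obtains \<phi> where
    "loewner_le (ptrace2 (reindex (\<lambda>((s, e), (l, p)). ((s, l, e), p)) (ketbra \<phi>))) \<rho>'"
    "fid \<rho>' (ptrace2 (reindex (\<lambda>((s, e), (l, p)). ((s, l, e), p)) (ketbra \<psi>))) \<le> fid (ketbra \<phi>) (ketbra \<psi>)"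
proof -
  let ?f = "\<lambda>((s, e), (l, p)). ((s, l, e), p)"
  let ?m = "\<lambda>\<phi>. ptrace2 (reindex ?f (ketbra \<phi>)) :: ('s \<times> 'e) qop"
  let ?A = "\<lambda>\<phi> x y. \<phi> (?f (x, y))"
  have m: "?m \<phi> = mmult (?A \<phi>) (adjoint (?A \<phi>))" for \<phi>
    by (simp add: ptrace2_def reindex_def ketbra_def mmult_def adjoint_def)
  obtain B where B: "loewner_le (mmult B (adjoint B)) \<rho>'"
    "fid \<rho>' (?m \<psi>) = Re (mtrace (mmult (?A \<psi>) (adjoint B)))"
    unfolding m by (rule fid_attained[OF psd])
  define \<phi> where "\<phi> = (\<lambda>((s, l, e), p). B (s, e) (l, p))"
  have A: "?A \<phi> = B" by (auto simp: \<phi>_def fun_eq_iff)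
  have "mtrace (mmult (?A \<psi>) (adjoint B)) = (\<Sum>x\<in>UNIV. \<psi> (?f x) * cnj (\<phi> (?f x)))"
    unfolding mtrace_mmult_adjoint A[symmetric] sum_UNIV_prod[of "\<lambda>x. \<psi> (?f x) * _ x"] ..
  also have "\<dots> = (\<Sum>x\<in>UNIV. \<psi> x * cnj (\<phi> x))"
    by (rule sum.reindex_bij_betw[OF bij_regroup(5)])
  finally have "Re (mtrace (mmult (?A \<psi>) (adjoint B))) = Re (\<Sum>x\<in>UNIV. \<phi> x * cnj (\<psi> x))"
    by (simp add: mult.commute)
  also have "\<dots> \<le> fid (ketbra \<phi>) (ketbra \<psi>)"
    using fid_ge[of "\<lambda>i (_::unit). \<phi> i" "\<lambda>i _. \<psi> i"]
    unfolding mtrace_mmult_adjoint by (simp flip: ketbra_eq_mmult)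
  finally have "fid \<rho>' (?m \<psi>) \<le> fid (ketbra \<phi>) (ketbra \<psi>)" using B(2) by simp
  moreover have "loewner_le (?m \<phi>) \<rho>'" unfolding m A by (rule B(1))
  ultimately show ?thesis using that by blast
qed

text \<open>The parameter \<open>c\<close> treats both kinds of message together: the loss is the
  logarithm of \<open>c\<close> times \<open>|Q|\<close>, with \<open>c = |Q|\<close> in general and
  \<open>c = 1\<close> for a classical register.\<close>

lemma smooth_Hmin_up_redistribution:
  fixes \<rho> :: "('s::finite \<times> 'l::finite \<times> 'e::finite) qop"
    and \<psi> :: "('s \<times> 'l \<times> 'e) \<times> ('p::finite) \<Rightarrow> complex"
    and \<rho>XY :: "('x::finite \<times> 'y::finite) qop"
    and Enc :: "('l \<times> 'p \<times> 'x) qop \<Rightarrow> ('p \<times> 'q::finite) qop"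
    and Dec :: "('q \<times> 'e \<times> 'y) qop \<Rightarrow> ('l \<times> 'e) qop"
  assumes rho: "density_eq \<rho>" and purif: "ptrace2 (ketbra \<psi>) = \<rho>" and delta: "0 \<le> \<delta>"
    and rhoXY: "density_eq \<rho>XY" and Enc: "is_channel Enc" and Dec: "is_channel Dec"
    and protocol: "purified_dist (reindex (\<lambda>((s, p), (l, e)). ((s, l, e), p)) (ketbra \<psi>))
        (redistribute Enc Dec \<rho>XY (ketbra \<psi>)) \<le> \<delta>"
    and eps: "0 \<le> \<epsilon>" "\<epsilon> + \<delta> < 1"
    and c: "c = real CARD('q) \<or>
      c = 1 \<and> (\<forall>M. density_eq M \<longrightarrow> (\<forall>p q p' q'. q \<noteq> q' \<longrightarrow> Enc M (p, q) (p', q') = 0))"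
  shows "smooth_Hmin_up \<epsilon> (ptrace2 (reindex (\<lambda>((s, e), l). (s, l, e)) \<rho>)) - ereal (log 2 (c * real CARD('q)))
    \<le> smooth_Hmin_up (\<epsilon> + \<delta>) \<rho>"
proof -
  define N :: "(('s \<times> 'l \<times> 'e) \<times> 'p) qop \<Rightarrow> ('s \<times> 'l \<times> 'e) qop" where "N = (\<lambda>M. discard (redistribute Enc Dec \<rho>XY M))"
  have pXY: "psd \<rho>XY" "mtrace \<rho>XY = 1" using rhoXY by (simp_all add: density_eq_def)
  note cpR = cp_redistribute[OF is_channel_cp[OF Enc] is_channel_cp[OF Dec] pXY(1)]
  note tpR = trace_preserving_redistribute[OF is_channel_trace_preserving[OF Enc]
      is_channel_trace_preserving[OF Dec] pXY(2)]
  have N: "cp N" unfolding N_def by (rule cp_comp[OF cpR cp_discard])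
  have tpN: "trace_preserving N"
    by (simp add: trace_preserving_def N_def tpR[unfolded trace_preserving_def, rule_format]
        trace_preserving_discard[unfolded trace_preserving_def, rule_format])
  define \<omega> where "\<omega> = N (ketbra \<psi>)"
  have trpsi: "mtrace (ketbra \<psi>) = 1"
    using rho unfolding purif[symmetric] by (simp add: density_eq_def mtrace_ptrace2)
  have \<omega>: "psd \<omega>" "mtrace \<omega> = 1"
    using N tpN trpsi by (simp_all add: \<omega>_def cp_psd psd_ketbra trace_preserving_def)
  \<comment> \<open>Discarding \<open>P\<close> cannot decrease the fidelity, so the guarantee of
    the protocol passes to the marginals on \<open>SLE\<close>.\<close>
  have g: "1 - (fid \<rho> \<omega>)\<^sup>2 \<le> \<delta>\<^sup>2"
  proof -
    let ?\<psi> = "reindex (\<lambda>((s, p), (l, e)). ((s, l, e), p)) (ketbra \<psi>)"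
    let ?\<omega> = "redistribute Enc Dec \<rho>XY (ketbra \<psi>)"
    have "fid ?\<psi> ?\<omega> \<le> fid (discard ?\<psi>) (discard ?\<omega>)"
      by (intro fid_cp_mono cp_discard trace_preserving_discard cp_psd[OF cp_reindex] cp_psd[OF cpR] psd_ketbra)
    moreover have "discard ?\<psi> = \<rho>"
      unfolding purif[symmetric] by (auto simp: fun_eq_iff discard_entry ptrace2_def reindex_def)
    ultimately have "fid ?\<psi> ?\<omega> \<le> fid \<rho> \<omega>" by (simp add: \<omega>_def N_def)
    then have "(fid ?\<psi> ?\<omega>)\<^sup>2 \<le> (fid \<rho> \<omega>)\<^sup>2" by (intro power_mono fid_nonneg)
    moreover have "mtrace ?\<omega> = 1" by (simp add: tpR[unfolded trace_preserving_def, rule_format] trpsi)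
    then have "1 - (fid ?\<psi> ?\<omega>)\<^sup>2 \<le> \<delta>\<^sup>2" using protocol purified_dist_le_iff delta by blast
    ultimately show ?thesis by simp
  qed
  let ?m = "\<lambda>M. ptrace2 (reindex (\<lambda>((s, e), (l, p)). ((s, l, e), p)) M) :: ('s \<times> 'e) qop"
  have SE: "ptrace2 (reindex (\<lambda>((s, e), l). (s, l, e)) \<rho>) = ?m (ketbra \<psi>)"
    unfolding purif[symmetric] by (auto simp: fun_eq_iff ptrace2_def reindex_def sum_UNIV_prod)
  have trSE: "mtrace (?m (ketbra \<psi>)) = 1"
    by (simp add: mtrace_ptrace2 mtrace_reindex bij_regroup trpsi)
  have cq: "0 < c * real CARD('q)" using c by auto
  have step: "Hmin_up \<rho>' - ereal (log 2 (c * real CARD('q))) \<le> smooth_Hmin_up (\<epsilon> + \<delta>) \<rho>"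
    if \<rho>': "density_le \<rho>'" and dist: "purified_dist \<rho>' (?m (ketbra \<psi>)) \<le> \<epsilon>" for \<rho>'
  proof -
    obtain \<phi> where \<phi>: "loewner_le (?m (ketbra \<phi>)) \<rho>'"
      "fid \<rho>' (?m (ketbra \<psi>)) \<le> fid (ketbra \<phi>) (ketbra \<psi>)"
      using \<rho>' unfolding density_le_def by (elim conjE) (rule smooth_extension)
    define \<tau> where "\<tau> = N (ketbra \<phi>)"
    have "mtrace \<tau> = mtrace (?m (ketbra \<phi>))"
      using tpN by (simp add: \<tau>_def trace_preserving_def mtrace_ptrace2 mtrace_reindex bij_regroup)
    then have tr\<tau>: "Re (mtrace \<tau>) \<le> 1"
      using loewner_le_mtrace[OF \<phi>(1)] \<rho>' by (simp add: density_le_def)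
    have psd\<tau>: "psd \<tau>" unfolding \<tau>_def by (intro cp_psd[OF N] psd_ketbra)
    have "fid \<rho>' (?m (ketbra \<psi>)) \<le> fid \<tau> \<omega>"
      using \<phi>(2) fid_cp_mono[OF N tpN psd_ketbra psd_ketbra] unfolding \<tau>_def \<omega>_def by (rule order_trans)
    then have "(fid \<rho>' (?m (ketbra \<psi>)))\<^sup>2 \<le> (fid \<tau> \<omega>)\<^sup>2" by (intro power_mono fid_nonneg)
    then have f: "1 - (fid \<tau> \<omega>)\<^sup>2 \<le> \<epsilon>\<^sup>2"
      using dist purified_dist_le_iff[OF trSE eps(1)] by (meson diff_left_mono order_trans)
    have psd\<rho>: "psd \<rho>" and tr\<rho>: "mtrace \<rho> = 1" using rho by (simp_all add: density_eq_def)
    \<comment> \<open>The middle point is the normalised output \<open>\<omega>\<close> on the true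
      state: \<open>\<tau>\<close> is close to it by smoothing, \<open>\<rho>\<close> by the
      protocol.\<close>
    have h: "fid \<tau> \<omega> * fid \<rho> \<omega> - sqrt (1 - (fid \<tau> \<omega>)\<^sup>2) * sqrt (1 - (fid \<rho> \<omega>)\<^sup>2) \<le> fid \<tau> \<rho>"
      and f1: "fid \<tau> \<omega> \<le> 1"
      using fid_triangle[OF psd\<tau> \<omega>(1) psd\<rho> tr\<tau>] by (simp_all add: \<omega> tr\<rho>)
    have g1: "fid \<rho> \<omega> \<le> 1"
      using fid_triangle(2)[OF psd\<rho> \<omega>(1) psd\<rho>] by (simp add: \<omega> tr\<rho>)
    have "1 - (fid \<tau> \<rho>)\<^sup>2 \<le> (\<epsilon> + \<delta>)\<^sup>2"
      by (rule sine_addition_bound[OF fid_nonneg f1 f fid_nonneg g1 g eps(1) delta eps(2) h])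
    then have "purified_dist \<tau> \<rho> \<le> \<epsilon> + \<delta>"
      using purified_dist_le_iff[OF tr\<rho>, of "\<epsilon> + \<delta>"] eps delta by simp
    then have "Hmin_up \<tau> \<le> smooth_Hmin_up (\<epsilon> + \<delta>) \<rho>"
      unfolding smooth_Hmin_up_def using psd\<tau> tr\<tau> by (intro SUP_upper) (simp add: density_le_def)
    moreover have "Hmin_up \<rho>' - ereal (log 2 (c * real CARD('q))) \<le> Hmin_up \<tau>"
    proof (rule Hmin_up_mono[OF cq])
      fix \<sigma> :: "'e qop" and \<mu> :: real
      assume \<sigma>: "density_le \<sigma>" "0 \<le> \<mu>" and
        "loewner_le \<rho>' (\<lambda>i j. complex_of_real \<mu> * tensor idm \<sigma> i j)"
      from loewner_le_trans[OF \<phi>(1) this(3)]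
      show "\<exists>\<sigma>'. density_le \<sigma>' \<and>
          loewner_le \<tau> (\<lambda>i j. complex_of_real (c * real CARD('q) * \<mu>) * tensor idm \<sigma>' i j)"
        unfolding \<tau>_def N_def
        by (rule discard_redistribute_bound[OF psd_ketbra rhoXY Enc Dec c \<sigma>])
    qed
    ultimately show ?thesis by (rule order_trans[rotated])
  qed
  have "smooth_Hmin_up \<epsilon> (?m (ketbra \<psi>)) \<le> smooth_Hmin_up (\<epsilon> + \<delta>) \<rho> + ereal (log 2 (c * real CARD('q)))"
    unfolding smooth_Hmin_up_def[of \<epsilon>]
  proof (rule SUP_least)
    fix \<rho>' :: "('s \<times> 'e) qop"
    assume "\<rho>' \<in> {\<rho>'. density_le \<rho>' \<and> purified_dist \<rho>' (?m (ketbra \<psi>)) \<le> \<epsilon>}"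
    then show "Hmin_up \<rho>' \<le> smooth_Hmin_up (\<epsilon> + \<delta>) \<rho> + ereal (log 2 (c * real CARD('q)))"
      using step[of \<rho>'] by (simp add: ereal_minus_le)
  qed
  then show ?thesis unfolding SE by (simp add: ereal_minus_le)
qed

theorem mainTheorem1:
  fixes \<rho> :: "('s::finite \<times> 'l::finite \<times> 'e::finite) qop"
    and \<psi> :: "('s \<times> 'l \<times> 'e) \<times> ('p::finite) \<Rightarrow> complex"
    and \<rho>XY :: "('x::finite \<times> 'y::finite) qop"
    and Enc :: "('l \<times> 'p \<times> 'x) qop \<Rightarrow> ('p \<times> 'q::finite) qop"
    and Dec :: "('q \<times> 'e \<times> 'y) qop \<Rightarrow> ('l \<times> 'e) qop"
    and \<delta> \<epsilon> :: real
  assumes rho: "density_eq \<rho>"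
    and purif: "(\<Sum>i\<in>UNIV. cmod (\<psi> i) ^ 2) = 1" "ptrace2 (ketbra \<psi>) = \<rho>"
    and delta: "0 \<le> \<delta>"
    and rhoXY: "density_eq \<rho>XY"
    and Enc: "is_channel Enc" and Dec: "is_channel Dec"
    and protocol: "purified_dist
        (reindex (\<lambda>((s, p), (l, e)). ((s, l, e), p)) (ketbra \<psi>))
        (app2 Dec (reindex (\<lambda>((s, p), (q, e, y)). ((s, e, y), (p, q)))
          (app2 Enc (reindex (\<lambda>((s, e, y), (l, p, x)). (((s, l, e), p), (x, y)))
             (tensor (ketbra \<psi>) \<rho>XY))))) \<le> \<delta>"
    and eps: "0 \<le> \<epsilon>" "\<epsilon> < 1" "\<epsilon> + \<delta> < 1"
  shows "smooth_Hmin_up (\<epsilon> + \<delta>) \<rho>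
           \<ge> smooth_Hmin_up \<epsilon> (ptrace2 (reindex (\<lambda>((s, e), l). (s, l, e)) \<rho>))
              - ereal (2 * log 2 (real (card (UNIV :: 'q set))))
       \<and> ((\<forall>M. density_eq M \<longrightarrow> (\<forall>p q p' q'. q \<noteq> q' \<longrightarrow> Enc M (p, q) (p', q') = 0)) \<longrightarrow>
           smooth_Hmin_up (\<epsilon> + \<delta>) \<rho>
           \<ge> smooth_Hmin_up \<epsilon> (ptrace2 (reindex (\<lambda>((s, e), l). (s, l, e)) \<rho>))
              - ereal (log 2 (real (card (UNIV :: 'q set)))))"
proof -
  have p: "purified_dist (reindex (\<lambda>((s, p), (l, e)). ((s, l, e), p)) (ketbra \<psi>))
      (redistribute Enc Dec \<rho>XY (ketbra \<psi>)) \<le> \<delta>"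
    using protocol by (simp only: redistribute_def)
  note bound = smooth_Hmin_up_redistribution[OF rho purif(2) delta rhoXY Enc Dec p eps(1) eps(3)]
  have "log 2 (real CARD('q) * real CARD('q)) = 2 * log 2 (real CARD('q))"
    by (simp add: log_mult)
  then show ?thesis using bound[of "real CARD('q)"] bound[of 1] by simp
qed

end
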